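(* Let $\mathcal{A}=\{a_1,\dots,a_n\}\subset\mathbb{Z}^d$ be such that the matrix $A\in\mathbb{Z}^{(d+1)\times n}$ with columns $(1,a_1),\dots,(1,a_n)$ has rank $d+1$, let $C=(c_{ij})\in\mathbb{R}^{d\times n}$ have rank $d$, let $B=(b_{ij})\in\mathbb{Z}^{n\times k}$ be a $\mathbb{Z}$-Gale dual matrix of $A$ and let $D\in\mathbb{R}^{n\times(k+1)}$ be a Gale dual matrix of $C$ with rows $P_1,\dots,P_n$. Consider the polynomial system $$(\mathrm{S})\quad \sum_{j=1}^n c_{ij}x^{a_j}=0,\ i=1,\dots,d,$$ and the Gale dual system $$(\mathrm{G})\quad \prod_{i=1}^n\langle P_i,y\rangle^{b_{ij}}=1,\ j=1,\dots,k.$$ If $\operatorname{rk}([A]_2)=d+1$, then there exists a solution of (S) in $(\mathbb{R}^* )^d$ if and only if there exists a solution of (G) in $\mathcal{M}_P$. More generally, when $\operatorname{rk}([A]_2)$ is not necessarily equal to $d+1$, there exists a solution of (S) in $(\mathbb{R}^* )^d$ if and only if there exists a solution of (G) in a cone $\mathcal{C}^\nu_\varepsilon$ with $\varepsilon\in\Omega$. Moreover, the number of solutions of (S) in $(\mathbb{R}^* )^d$ is equal to $2^{d-\operatorname{rk}([A]_2)}$ times the sum of the numbers of solutions of (G) in the quotient cones $\mathbb{P}\mathcal{C}^\nu_\varepsilon$, over all $\varepsilon\in\Omega$ (taken modulo $2$, i.e. each class of $\varepsilon$ modulo $2\mathbb{Z}^n$ being counted once).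
   Context: Setting: $d\ge1$, $n\ge d+2$, $k=n-d-1$, the $a_i$ are distinct, $\mathbb{R}^*=\mathbb{R}\setminus\{0\}$. A Gale dual matrix of $M\in\mathbb{R}^{r\times s}$ of rank $r$ is any $N\in\mathbb{R}^{s\times(s-r)}$ whose columns form a basis of $\ker M$. A $\mathbb{Z}$-Gale dual matrix of $A$ is an integer Gale dual matrix whose maximal minors have greatest common divisor $1$ (equivalently, its columns form a $\mathbb{Z}$-basis of $\ker_{\mathbb{Z}}(A)$). $\mathcal{M}_P$ is the complement in $\mathbb{R}^{k+1}$ of the union of the sets $\{y\in\mathbb{R}^{k+1}:\langle P_i,y\rangle=0\}$, $i=1,\dots,n$. For $\varepsilon\in\mathbb{Z}^n$, $\mathcal{C}^\nu_\varepsilon=\{y\in\mathbb{R}^{k+1}:(-1)^{\varepsilon_i}\langle P_i,y\rangle>0,\ i=1,\dots,n\}$ (it depends only on $\varepsilon$ modulo $2$), and $\mathbb{P}\mathcal{C}^\nu_\varepsilon$ is its quotient by the relation $y\sim y'$ iff $y=\alpha y'$ for some $\alpha>0$. System (G) is homogeneous of degree $0$, so its solutions in $\mathbb{P}\mathcal{C}^\nu_\varepsilon$ are well defined. For an integer matrix or vector $M$, $[M]_2$ denotes its entrywise reduction in $\mathbb{Z}/2\mathbb{Z}$, and $\operatorname{rk}([M]_2)$ is the rank over $\mathbb{Z}/2\mathbb{Z}$. The feasible set is $\Omega=\{\varepsilon\in\mathbb{Z}^n:\langle[\varepsilon]_2,\beta\rangle=0\text{ for all }\beta\in\ker([A]_2)\}$,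 where $\ker([A]_2)\subset(\mathbb{Z}/2\mathbb{Z})^n$. *)

theory Defs
  imports
    "HOL-Library.Extended_Nonnegative_Real"
    "HOL-Library.Z2"
    "Jordan_Normal_Form.Matrix_Kernel"
    "Jordan_Normal_Form.DL_Rank"
    "Jordan_Normal_Form.DL_Submatrix"
begin

text \<open>All indices start at 0: the points are $a_0, \dots, a_{n-1}$, and row 0 of the matrix
  below is the row of ones.\<close>

definition point_matrix :: "nat \<Rightarrow> nat \<Rightarrow> (nat \<Rightarrow> int vec) \<Rightarrow> int mat" where
  "point_matrix d n a = mat_of_cols (d + 1) (map (\<lambda>j. vCons 1 (a j)) [0..<n])"

abbreviation real_mat :: "int mat \<Rightarrow> real mat" where
  "real_mat M \<equiv> map_mat real_of_int M"

abbreviation mat_mod2 :: "int mat \<Rightarrow> bit mat" where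
  "mat_mod2 M \<equiv> map_mat of_int M"

abbreviation vec_mod2 :: "int vec \<Rightarrow> bit vec" where
  "vec_mod2 v \<equiv> map_vec of_int v"

text \<open>Meant for matrices \<^term>\<open>M\<close> of full row rank. A basis is a set in the library, so the
  columns are also required to be distinct.\<close>

definition gale_dual :: "real mat \<Rightarrow> real mat \<Rightarrow> bool" where
  "gale_dual M N \<longleftrightarrow>
     N \<in> carrier_mat (dim_col M) (dim_col M - dim_row M) \<and>
     distinct (cols N) \<and>
     kernel.basis (dim_col M) M (set (cols N))"

definition maximal_minors :: "int mat \<Rightarrow> int set" where
  "maximal_minors N =
     {det (submatrix N I {..<dim_col N}) | I. I \<subseteq> {..<dim_row N} \<and> card I = dim_col N}"

definition int_gale_dual :: "int mat \<Rightarrow> int mat \<Rightarrow> bool" where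
  "int_gale_dual M N \<longleftrightarrow> gale_dual (real_mat M) (real_mat N) \<and> Gcd (maximal_minors N) = 1"

definition monomial :: "nat \<Rightarrow> real vec \<Rightarrow> int vec \<Rightarrow> real" where
  "monomial d x e = (\<Prod>l<d. (x $ l) powi (e $ l))"

definition torus_solutions :: "nat \<Rightarrow> nat \<Rightarrow> (nat \<Rightarrow> int vec) \<Rightarrow> real mat \<Rightarrow> real vec set" where
  "torus_solutions d n a C =
     {x \<in> carrier_vec d. (\<forall>l<d. x $ l \<noteq> 0) \<and>
        (\<forall>i<d. (\<Sum>j<n. C $$ (i, j) * monomial d x (a j)) = 0)}"

text \<open>For negative exponents the system (G) only makes sense where no linear form vanishes, whereas
  \<^term>\<open>0 powi m\<close> is total. The predicate below is only ever used on \<open>form_complement\<close> and on the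
  cones, where no form vanishes.\<close>

definition gale_system :: "int mat \<Rightarrow> real mat \<Rightarrow> real vec \<Rightarrow> bool" where
  "gale_system B D y \<longleftrightarrow>
     (\<forall>j<dim_col B. (\<Prod>i<dim_row B. (row D i \<bullet> y) powi (B $$ (i, j))) = 1)"

definition form_complement :: "real mat \<Rightarrow> real vec set" where
  "form_complement D =
     carrier_vec (dim_col D) - (\<Union>i<dim_row D. {y \<in> carrier_vec (dim_col D). row D i \<bullet> y = 0})"

definition sign_cone :: "real mat \<Rightarrow> int vec \<Rightarrow> real vec set" where
  "sign_cone D \<epsilon> =
     {y \<in> carrier_vec (dim_col D). \<forall>i<dim_row D. (-1) powi (\<epsilon> $ i) * (row D i \<bullet> y) > 0}"

definition ray_rel :: "nat \<Rightarrow> (real vec \<times> real vec) set" where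
  "ray_rel m =
     {(y, y'). y \<in> carrier_vec m \<and> y' \<in> carrier_vec m \<and> (\<exists>\<alpha>>0. y = \<alpha> \<cdot>\<^sub>v y')}"

definition quotient_cone :: "real mat \<Rightarrow> int vec \<Rightarrow> real vec set set" where
  "quotient_cone D \<epsilon> = sign_cone D \<epsilon> // ray_rel (dim_col D)"

text \<open>When the columns of \<^term>\<open>B\<close> sum to zero, (G) is homogeneous of degree 0, so that one
  representative of a ray solves it if and only if all of them do.\<close>

definition quotient_cone_solutions :: "int mat \<Rightarrow> real mat \<Rightarrow> int vec \<Rightarrow> real vec set set" where
  "quotient_cone_solutions B D \<epsilon> = {Y \<in> quotient_cone D \<epsilon>. \<exists>y\<in>Y. gale_system B D y}"

definition feasible :: "int mat \<Rightarrow> int vec set" where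
  "feasible A =
     {\<epsilon> \<in> carrier_vec (dim_col A). \<forall>\<beta> \<in> mat_kernel (mat_mod2 A). vec_mod2 \<epsilon> \<bullet> \<beta> = 0}"

text \<open>One representative, with entries 0 and 1, of each class of \<^term>\<open>feasible A\<close> modulo 2.\<close>

definition feasible_mod2 :: "int mat \<Rightarrow> int vec set" where
  "feasible_mod2 A = {\<epsilon> \<in> feasible A. \<forall>i<dim_col A. \<epsilon> $ i \<in> {0, 1}}"

text \<open>Unlike \<^term>\<open>card\<close>, the count is infinite on infinite sets.\<close>

definition num_elems :: "'a set \<Rightarrow> ennreal" where
  "num_elems S = (if finite S then of_nat (card S) else \<infinity>)"

end

(* Write z = D y. A solution x of (S) gives z_j = x^(a_j), whose signs form the vector [A]_2^T (0, s)
   over F_2, where s records the signs of x, and whose absolute values are exp of the affine form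
   with linear part u = log |x|. Conversely, (G) says that log |z| is orthogonal to the columns of B,
   so that by duality log |z| = A^T (c, u); rescaling y removes c. Hence both systems become, for a
   sign pattern w, the same real system in u (reduced_solutions below). The map t |-> [A]_2^T t on
   F_2^(d+1) has image Omega mod 2 and fibres of size 2^(d+1-r), where r = rk [A]_2; the vectors (0, s)
   and (1, s) give opposite patterns, i.e. the same reduced system, which accounts for a factor 2. *)

theory Submission
  imports Defs
begin

section \<open>Linear algebra over a field\<close>

text \<open>The exponent d - r is -1 exactly when [A]_2 has rank d + 1: then each \<open>x\<close>
  is seen from two opposite feasible cones, by \<open>y\<close> and by \<open>-y\<close>. The factor
  is therefore a real power of 2, and the count is derived for twice the number of solutions, the 2
  being cancelled at the end in \<open>ennreal\<close>, where solution sets may be infinite. For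
  every A the columns of [B]_2 lie in ker [A]_2, because A B = 0 holds over the integers. Hence a
  feasible pattern satisfies the parity part of (G), but a solution of (G) may sit in a cone that is
  not feasible. The first claim needs equality of im [B]_2 and ker [A]_2, which comes from a count:
  some maximal minor of B is odd, since their gcd is 1, so [B]_2 is injective and its image has
  2^(n-d-1) elements, the size of ker [A]_2 at full rank. Over F_2 a nonzero vector can be
  orthogonal to itself, so row spaces are recovered from kernels by elimination, not by orthogonal
  projection; the same argument then serves the logarithms over the reals and the signs over
  F_2.\<close>

lemma inj_on_mult_mat_vec:
  fixes M :: "'a :: comm_ring_1 mat"
  assumes M: "M \<in> carrier_mat r s"
    and ker: "\<And>v. v \<in> carrier_vec s \<Longrightarrow> M *\<^sub>v v = 0\<^sub>v r \<Longrightarrow> v = 0\<^sub>v s"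
  shows "inj_on (\<lambda>v. M *\<^sub>v v) (carrier_vec s)"
proof (rule inj_onI)
  fix x y
  assume x: "x \<in> carrier_vec s" and y: "y \<in> carrier_vec s" and eq: "M *\<^sub>v x = M *\<^sub>v y"
  have xy: "x - y = 0\<^sub>v s"
    using ker[of "x - y"] eq x y M by (simp add: mult_minus_distrib_mat_vec)
  show "x = y"
  proof (rule eq_vecI)
    show "dim_vec x = dim_vec y"
      using x y by simp
    show "x $ i = y $ i" if "i < dim_vec y" for i
      using arg_cong[OF xy, of "\<lambda>v. v $ i"] that x y by simp
  qed
qed

text \<open>Elimination, by induction on the number of forms. If \<open>f m\<close> vanishes on the
  common kernel of the earlier forms, it gets coefficient 0. Otherwise subtract from
  \<open>w\<close> the multiple of \<open>f m\<close> that makes it vanish at a vector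
  \<open>v\<close> killed by the earlier forms but not by \<open>f m\<close>; the difference
  vanishes on the whole kernel of the first \<open>m\<close> forms.\<close>

lemma kernel_le_imp_linear_combination:
  fixes f :: "nat \<Rightarrow> 'a :: field vec"
  assumes "\<And>i. i < m \<Longrightarrow> f i \<in> carrier_vec n"
    and "w \<in> carrier_vec n"
    and "\<And>v. v \<in> carrier_vec n \<Longrightarrow> (\<And>i. i < m \<Longrightarrow> f i \<bullet> v = 0) \<Longrightarrow> w \<bullet> v = 0"
  shows "\<exists>c. \<forall>v\<in>carrier_vec n. w \<bullet> v = (\<Sum>i<m. c i * (f i \<bullet> v))"
  using assms
proof (induction m arbitrary: w)
  case 0
  then show ?case by auto
next
  case (Suc m)
  have fm: "f m \<in> carrier_vec n" and fi: "\<And>i. i < m \<Longrightarrow> f i \<in> carrier_vec n"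
    using Suc.prems(1) by auto
  show ?case
  proof (cases "\<exists>v\<in>carrier_vec n. (\<forall>i<m. f i \<bullet> v = 0) \<and> f m \<bullet> v \<noteq> 0")
    case True
    then obtain v where v: "v \<in> carrier_vec n" "\<And>i. i < m \<Longrightarrow> f i \<bullet> v = 0" "f m \<bullet> v \<noteq> 0"
      by blast
    define q where "q = (w \<bullet> v) / (f m \<bullet> v)"
    have w': "w - q \<cdot>\<^sub>v f m \<in> carrier_vec n"
      using Suc.prems(2) fm by simp
    have expand: "(w - q \<cdot>\<^sub>v f m) \<bullet> u = w \<bullet> u - q * (f m \<bullet> u)" if "u \<in> carrier_vec n" for u
      using that Suc.prems(2) fm by (simp add: minus_scalar_prod_distrib[of _ n])
    have "(w - q \<cdot>\<^sub>v f m) \<bullet> u = 0" if u: "u \<in> carrier_vec n" and "\<And>i. i < m \<Longrightarrow> f i \<bullet> u = 0" for u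
    proof -
      \<comment> \<open>Subtracting \<open>t\<close> times \<open>v\<close> from \<open>u\<close>
        keeps the first \<open>m\<close> forms at 0 and makes \<open>f m\<close> vanish too, so the
        hypothesis on \<open>w\<close> applies.\<close>
      define t where "t = (f m \<bullet> u) / (f m \<bullet> v)"
      have dist: "g \<bullet> (u - t \<cdot>\<^sub>v v) = g \<bullet> u - t * (g \<bullet> v)" if "g \<in> carrier_vec n" for g
        using that u v(1) by (simp add: scalar_prod_minus_distrib[of _ n])
      have "w \<bullet> (u - t \<cdot>\<^sub>v v) = 0"
      proof (rule Suc.prems(3))
        show "u - t \<cdot>\<^sub>v v \<in> carrier_vec n"
          using u v(1) by simp
        show "f i \<bullet> (u - t \<cdot>\<^sub>v v) = 0" if "i < Suc m" for i
          using that dist[OF Suc.prems(1)[OF that]] \<open>\<And>i. i < m \<Longrightarrow> f i \<bullet> u = 0\<close> v(2,3)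
          by (cases "i = m") (auto simp: t_def)
      qed
      then show ?thesis
        using dist[OF Suc.prems(2)] expand[OF u] by (simp add: q_def t_def field_simps)
    qed
    from Suc.IH[OF fi w' this] obtain c where
      c: "\<And>u. u \<in> carrier_vec n \<Longrightarrow> (w - q \<cdot>\<^sub>v f m) \<bullet> u = (\<Sum>i<m. c i * (f i \<bullet> u))"
      by blast
    have "w \<bullet> u = (\<Sum>i<Suc m. (c(m := q)) i * (f i \<bullet> u))" if "u \<in> carrier_vec n" for u
      using c[OF that] expand[OF that] by (simp add: algebra_simps)
    then show ?thesis by blast
  next
    case False
    have "w \<bullet> v = 0" if "v \<in> carrier_vec n" "\<And>i. i < m \<Longrightarrow> f i \<bullet> v = 0" for v
      using Suc.prems(3)[OF that(1)] that False by (metis less_Suc_eq)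
    from Suc.IH[OF fi Suc.prems(2) this] obtain c where
      c: "\<And>u. u \<in> carrier_vec n \<Longrightarrow> w \<bullet> u = (\<Sum>i<m. c i * (f i \<bullet> u))"
      by blast
    have "w \<bullet> u = (\<Sum>i<Suc m. (c(m := 0)) i * (f i \<bullet> u))" if "u \<in> carrier_vec n" for u
      using c[OF that] by simp
    then show ?thesis by blast
  qed
qed

text \<open>The forms are the rows of \<open>M\<close>; the coefficients of the resulting
  combination are the coordinates of \<open>y\<close>, as evaluation at unit vectors shows.\<close>

lemma orthogonal_to_kernel_imp_row_space:
  fixes M :: "'a :: field mat"
  assumes M: "M \<in> carrier_mat r s" and w: "w \<in> carrier_vec s"
    and orth: "\<And>v. v \<in> carrier_vec s \<Longrightarrow> M *\<^sub>v v = 0\<^sub>v r \<Longrightarrow> w \<bullet> v = 0"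
  obtains y where "y \<in> carrier_vec r" "M\<^sup>T *\<^sub>v y = w"
proof -
  have "w \<bullet> v = 0" if "v \<in> carrier_vec s" "\<And>i. i < r \<Longrightarrow> row M i \<bullet> v = 0" for v
    by (rule orth[OF that(1)]) (use M that in \<open>auto intro!: eq_vecI\<close>)
  from kernel_le_imp_linear_combination[of r "row M" s w, OF _ w this] M
  obtain c where c: "\<And>v. v \<in> carrier_vec s \<Longrightarrow> w \<bullet> v = (\<Sum>i<r. c i * (row M i \<bullet> v))"
    by (metis row_carrier_vec)
  have "M\<^sup>T *\<^sub>v vec r c = w"
  proof (rule eq_vecI)
    show "dim_vec (M\<^sup>T *\<^sub>v vec r c) = dim_vec w"
      using M w by simp
    fix j assume "j < dim_vec w"
    then have j: "j < s" using w by simp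
    have "w $ j = w \<bullet> unit_vec s j"
      using j w by simp
    also have "\<dots> = (\<Sum>i<r. c i * M $$ (i, j))"
      using c[of "unit_vec s j"] j M by simp
    also have "\<dots> = (M\<^sup>T *\<^sub>v vec r c) $ j"
      using j M by (simp add: scalar_prod_def lessThan_atLeast0 mult.commute)
    finally show "(M\<^sup>T *\<^sub>v vec r c) $ j = w $ j" ..
  qed
  then show thesis
    using that[of "vec r c"] by simp
qed

lemma scalar_prod_mult_transpose:
  fixes M :: "'a :: comm_ring_1 mat"
  assumes "M \<in> carrier_mat r s" "y \<in> carrier_vec r" "v \<in> carrier_vec s"
  shows "(M\<^sup>T *\<^sub>v y) \<bullet> v = y \<bullet> (M *\<^sub>v v)"
  using transpose_vec_mult_scalar[of M r s v y] assms by simp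

text \<open>Used over both fields: over the reals it writes the logarithms of the forms as values of
  an affine form on the points, over F_2 it identifies the feasible patterns with the image of the
  transpose of [A]_2.\<close>

lemma image_transpose_eq_kernel_annihilator:
  fixes M :: "'a :: field mat"
  assumes M: "M \<in> carrier_mat r s"
  shows "(\<lambda>y. M\<^sup>T *\<^sub>v y) ` carrier_vec r =
    {w \<in> carrier_vec s. \<forall>v\<in>mat_kernel M. w \<bullet> v = 0}" (is "?L = ?R")
proof
  show "?L \<subseteq> ?R"
    using M by (auto simp: mat_kernel_def scalar_prod_mult_transpose[OF M])
  show "?R \<subseteq> ?L"
  proof
    fix w assume "w \<in> ?R"
    then obtain y where "y \<in> carrier_vec r" "M\<^sup>T *\<^sub>v y = w"
      using orthogonal_to_kernel_imp_row_space[OF M, of w] M by (auto simp: mat_kernel_def)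
    then show "w \<in> ?L" by auto
  qed
qed

text \<open>The columns of \<open>N\<close> are a maximal independent subset of those of
  \<open>M\<close>. The rank thus becomes a number of free coordinates, in which the image of
  \<open>M\<close> is parametrised injectively.\<close>

lemma (in vec_space) rank_basis_matrix:
  assumes M: "M \<in> carrier_mat n nc"
  obtains N where "N \<in> carrier_mat n (rank M)"
    and "\<And>v. v \<in> carrier_vec (rank M) \<Longrightarrow> N *\<^sub>v v = 0\<^sub>v n \<Longrightarrow> v = 0\<^sub>v (rank M)"
    and "(\<lambda>v. N *\<^sub>v v) ` carrier_vec (rank M) = (\<lambda>v. M *\<^sub>v v) ` carrier_vec nc"
proof -
  let ?P = "\<lambda>T. T \<subseteq> set (cols M) \<and> lin_indpt T"
  have cM: "set (cols M) \<subseteq> carrier_vec n"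
    using cols_dim M by blast
  obtain S where S: "maximal S ?P"
    using maximal_exists[of ?P "card (set (cols M))" "{}"]
    by (meson List.finite_set card_mono empty_iff empty_subsetI finite_lin_indpt2 rev_finite_subset)
  have Ssub: "S \<subseteq> set (cols M)" and Sli: "lin_indpt S"
    using S by (auto simp: maximal_def)
  have card_S: "rank M = card S"
    by (rule rank_card_indpt[OF M S])
  have "finite S" using Ssub finite_subset by blast
  then obtain ss where ss: "set ss = S" "distinct ss"
    using finite_distinct_list by blast
  have len: "length ss = rank M"
    using ss card_S distinct_card by fastforce
  define N where "N = mat_of_cols n ss"
  have cN: "cols N = ss"
    unfolding N_def by (rule cols_mat_of_cols) (use ss Ssub cM in auto)
  have N: "N \<in> carrier_mat n (rank M)"
    unfolding N_def using len by auto
  have sp: "span S = span (set (cols M))"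
  proof
    show "span S \<subseteq> span (set (cols M))"
      by (rule span_is_monotone[OF Ssub])
    \<comment> \<open>A column outside \<open>span S\<close> could be adjoined to \<open>S\<close>,
      against maximality.\<close>
    have "c \<in> span S" if c: "c \<in> set (cols M)" for c
    proof (rule ccontr)
      assume nin: "c \<notin> span S"
      then have "lin_indpt (S \<union> {c})"
        using lindep_span lin_dep_iff_in_span
        by (meson Ssub Sli cM c in_own_span subset_iff subset_trans)
      moreover have "c \<notin> S"
        using nin Ssub cM in_own_span by blast
      ultimately show False
        using S c Ssub unfolding maximal_def by blast
    qed
    then show "span (set (cols M)) \<subseteq> span S"
      by (meson Ssub cM span_subsetI subsetI subset_trans span_is_subset span_is_submodule)
  qed
  have "(\<lambda>v. N *\<^sub>v v) ` carrier_vec (rank M) = col_space N"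
    using N by (auto simp: col_space_eq[OF N])
  also have "\<dots> = col_space M"
    using sp cN ss by (simp add: col_space_def)
  also have "\<dots> = (\<lambda>v. M *\<^sub>v v) ` carrier_vec nc"
    using M by (auto simp: col_space_eq[OF M])
  finally have im: "(\<lambda>v. N *\<^sub>v v) ` carrier_vec (rank M) = (\<lambda>v. M *\<^sub>v v) ` carrier_vec nc" .
  have "v = 0\<^sub>v (rank M)" if "v \<in> carrier_vec (rank M)" "N *\<^sub>v v = 0\<^sub>v n" for v
    using lin_depI[OF N that(1) _ that(2)] cN ss Sli by auto
  with that[OF N _ im] show thesis by blast
qed

text \<open>Turns a basis of the kernel into an injective parametrisation of it. Distinctness of the
  columns enters in the third claim: a relation with nonzero coefficients contradicts independence
  of the set of columns only if no column is repeated.\<close>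

lemma gale_dual_kernel:
  assumes gd: "gale_dual M N" and M: "M \<in> carrier_mat r s"
  shows "N \<in> carrier_mat s (s - r)"
    and "mat_kernel M = (\<lambda>y. N *\<^sub>v y) ` carrier_vec (s - r)"
    and "\<And>y. y \<in> carrier_vec (s - r) \<Longrightarrow> N *\<^sub>v y = 0\<^sub>v s \<Longrightarrow> y = 0\<^sub>v (s - r)"
proof -
  show N: "N \<in> carrier_mat s (s - r)"
    using gd M by (auto simp: gale_dual_def)
  interpret kernel r s M
    by unfold_locales (rule M)
  have dist: "distinct (cols N)" and bas: "basis (set (cols N))"
    using gd M by (auto simp: gale_dual_def)
  have sub: "set (cols N) \<subseteq> mat_kernel M" and sp: "span (set (cols N)) = mat_kernel M"
    and li: "lin_indpt (set (cols N))"
    using bas unfolding Ker.basis_def by auto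
  have "mat_kernel M = NC.col_space N"
    using sp span_same[OF sub] by (simp add: NC.col_space_def)
  then show "mat_kernel M = (\<lambda>y. N *\<^sub>v y) ` carrier_vec (s - r)"
    using N by (auto simp: NC.col_space_eq[OF N])
  show "y = 0\<^sub>v (s - r)" if "y \<in> carrier_vec (s - r)" "N *\<^sub>v y = 0\<^sub>v s" for y
    using NC.lin_depI[OF N that(1) _ that(2) dist] li lindep_same[OF sub] by auto
qed

text \<open>Row rank equals column rank, in the full rank case. A vector killed by the transpose is
  orthogonal to the columns of \<open>M\<close>, hence to those of a square \<open>N\<close> with
  the same column space; \<open>N\<close> is injective, so its transpose has nonzero
  determinant.\<close>

lemma full_row_rank_transpose_inj:
  fixes M :: "'a :: field mat"
  assumes M: "M \<in> carrier_mat r s" and rank: "vec_space.rank r M = r"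
    and y: "y \<in> carrier_vec r" "M\<^sup>T *\<^sub>v y = 0\<^sub>v s"
  shows "y = 0\<^sub>v r"
proof -
  interpret vec_space "TYPE('a)" r .
  obtain N where N: "N \<in> carrier_mat r r"
    and inj: "\<And>v. v \<in> carrier_vec r \<Longrightarrow> N *\<^sub>v v = 0\<^sub>v r \<Longrightarrow> v = 0\<^sub>v r"
    and im: "(\<lambda>v. N *\<^sub>v v) ` carrier_vec r = (\<lambda>v. M *\<^sub>v v) ` carrier_vec s"
    using rank_basis_matrix[OF M] rank by metis
  have "N\<^sup>T *\<^sub>v y = 0\<^sub>v r"
  proof (rule eq_vecI)
    fix i assume "i < dim_vec (0\<^sub>v r :: 'a vec)"
    then have i: "i < r" by simp
    have "N *\<^sub>v unit_vec r i \<in> (\<lambda>v. M *\<^sub>v v) ` carrier_vec s"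
      using im by (metis imageI unit_vec_carrier)
    then obtain v where v: "v \<in> carrier_vec s" "N *\<^sub>v unit_vec r i = M *\<^sub>v v"
      by blast
    have "(N\<^sup>T *\<^sub>v y) $ i = (N\<^sup>T *\<^sub>v y) \<bullet> unit_vec r i"
      using N y i by simp
    also have "\<dots> = (M\<^sup>T *\<^sub>v y) \<bullet> v"
      using scalar_prod_mult_transpose[OF N y(1), of "unit_vec r i"]
        scalar_prod_mult_transpose[OF M y(1) v(1)] v(2) by simp
    finally show "(N\<^sup>T *\<^sub>v y) $ i = 0\<^sub>v r $ i"
      using y(2) v(1) i by simp
  qed (use N in simp)
  moreover have "det N\<^sup>T \<noteq> 0"
    using det_transpose[OF N] det_0_iff_vec_prod_zero_field[OF N] inj by auto
  ultimately show ?thesis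
    using det_0_iff_vec_prod_zero_field[of "N\<^sup>T" r] N y(1) by auto
qed

section \<open>Counting over the field with two elements\<close>

lemma UNIV_bit: "(UNIV :: bit set) = {0, 1}"
  by (auto intro: bit.exhaust)

lemma of_int_bit: "(of_int z :: bit) = (if even z then 0 else 1)"
  proof (cases "even z")
  case True
  then obtain k where "z = 2 * k" by (elim evenE)
  then show ?thesis by simp
next
  case False
  then obtain k where "z = 2 * k + 1" by (elim oddE)
  then show ?thesis by simp
qed

lemma bij_betw_list_of_vec: "bij_betw list_of_vec (carrier_vec n) {xs. set xs \<subseteq> UNIV \<and> length xs = n}"
proof (rule bij_betwI)
  show "list_of_vec \<in> carrier_vec n \<rightarrow> {xs. set xs \<subseteq> UNIV \<and> length xs = n}"
    by (rule Pi_I) (simp add: carrier_vecD)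
  show "vec_of_list \<in> {xs :: 'a list. set xs \<subseteq> UNIV \<and> length xs = n} \<rightarrow> carrier_vec n"
    by (rule Pi_I, rule carrier_vecI) simp
qed (simp_all only: vec_list list_vec)

lemma finite_bit_vecs: "finite (carrier_vec n :: bit vec set)"
  using bij_betw_finite[OF bij_betw_list_of_vec, where ?'a1 = bit]
    finite_lists_length_eq[of "UNIV :: bit set" n] by (simp add: UNIV_bit)

lemma card_bit_vecs: "card (carrier_vec n :: bit vec set) = 2 ^ n"
proof -
  have "card (carrier_vec n :: bit vec set) = card {xs :: bit list. set xs \<subseteq> UNIV \<and> length xs = n}"
    by (rule bij_betw_same_card[OF bij_betw_list_of_vec])
  also have "\<dots> = card (UNIV :: bit set) ^ n"
    by (rule card_lists_length_eq) (simp add: UNIV_bit)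
  also have "card (UNIV :: bit set) = 2"
    by (simp add: UNIV_bit)
  finally show ?thesis .
qed

text \<open>The fibre through \<open>x\<close> is the translate of the kernel by
  \<open>x\<close>.\<close>

lemma card_fiber_mult_mat_vec:
  fixes M :: "'a :: comm_ring_1 mat"
  assumes M: "M \<in> carrier_mat r s" and x: "x \<in> carrier_vec s"
  shows "card {v \<in> carrier_vec s. M *\<^sub>v v = M *\<^sub>v x} = card {v \<in> carrier_vec s. M *\<^sub>v v = 0\<^sub>v r}"
proof (rule bij_betw_same_card[OF bij_betwI])
  show "(\<lambda>v. v - x) \<in> {v \<in> carrier_vec s. M *\<^sub>v v = M *\<^sub>v x} \<rightarrow> {v \<in> carrier_vec s. M *\<^sub>v v = 0\<^sub>v r}"
    using M x by (auto simp: mult_minus_distrib_mat_vec)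
  show "(\<lambda>v. v + x) \<in> {v \<in> carrier_vec s. M *\<^sub>v v = 0\<^sub>v r} \<rightarrow> {v \<in> carrier_vec s. M *\<^sub>v v = M *\<^sub>v x}"
    using M x by (auto simp: mult_add_distrib_mat_vec)
qed (use x in \<open>auto intro!: eq_vecI\<close>)

text \<open>All fibres have the size of the kernel; this is the origin of the power of 2. The values
  lie in a general semiring because solutions are counted in \<open>ennreal\<close> and the elements
  of images in \<open>nat\<close>.\<close>

lemma sum_over_image_mult_mat_vec:
  fixes M :: "bit mat" and g :: "bit vec \<Rightarrow> 'b :: comm_semiring_1"
  assumes M: "M \<in> carrier_mat r s"
  shows "(\<Sum>v\<in>carrier_vec s. g (M *\<^sub>v v)) =
    of_nat (card {v \<in> carrier_vec s. M *\<^sub>v v = 0\<^sub>v r}) * (\<Sum>w\<in>(\<lambda>v. M *\<^sub>v v) ` carrier_vec s. g w)"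
proof -
  let ?f = "\<lambda>v. M *\<^sub>v v"
  have "(\<Sum>v\<in>carrier_vec s. g (?f v)) =
      (\<Sum>w\<in>?f ` carrier_vec s. \<Sum>v\<in>{v \<in> carrier_vec s. ?f v = w}. g (?f v))"
    by (rule sum.image_gen[OF finite_bit_vecs])
  also have "\<dots> = (\<Sum>w\<in>?f ` carrier_vec s. of_nat (card {v \<in> carrier_vec s. ?f v = 0\<^sub>v r}) * g w)"
    by (rule sum.cong) (auto simp: card_fiber_mult_mat_vec[OF M])
  finally show ?thesis
    by (simp add: sum_distrib_left)
qed

lemma card_kernel_times_card_image:
  fixes M :: "bit mat"
  assumes M: "M \<in> carrier_mat r s"
  shows "card {v \<in> carrier_vec s. M *\<^sub>v v = 0\<^sub>v r} * card ((\<lambda>v. M *\<^sub>v v) ` carrier_vec s) = 2 ^ s"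
  using sum_over_image_mult_mat_vec[OF M, of "\<lambda>_. 1 :: nat"] by (simp add: card_bit_vecs)

lemma card_image_eq_two_power_rank:
  fixes M :: "bit mat"
  assumes M: "M \<in> carrier_mat r s"
  shows "card ((\<lambda>v. M *\<^sub>v v) ` carrier_vec s) = 2 ^ vec_space.rank r M"
proof -
  interpret vec_space "TYPE(bit)" r .
  obtain N where N: "N \<in> carrier_mat r (rank M)"
    and inj: "\<And>v. v \<in> carrier_vec (rank M) \<Longrightarrow> N *\<^sub>v v = 0\<^sub>v r \<Longrightarrow> v = 0\<^sub>v (rank M)"
    and im: "(\<lambda>v. N *\<^sub>v v) ` carrier_vec (rank M) = (\<lambda>v. M *\<^sub>v v) ` carrier_vec s"
    using rank_basis_matrix[OF M] by metis
  show ?thesis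
    using card_image[OF inj_on_mult_mat_vec[OF N inj]] im by (simp add: card_bit_vecs)
qed

text \<open>The kernel of a transpose is the annihilator of the column space, so it shrinks as the
  column space grows.\<close>

lemma kernel_transpose_cong_image:
  fixes M N :: "'a :: comm_ring_1 mat"
  assumes M: "M \<in> carrier_mat r s" and N: "N \<in> carrier_mat r t" 
    and im: "(\<lambda>v. N *\<^sub>v v) ` carrier_vec t \<subseteq> (\<lambda>v. M *\<^sub>v v) ` carrier_vec s"
    and y: "y \<in> carrier_vec r" "M\<^sup>T *\<^sub>v y = 0\<^sub>v s"
  shows "N\<^sup>T *\<^sub>v y = 0\<^sub>v t"
proof (rule eq_vecI)
  fix i assume "i < dim_vec (0\<^sub>v t :: 'a vec)"
  then have i: "i < t" by simp
  obtain v where v: "v \<in> carrier_vec s" "N *\<^sub>v unit_vec t i = M *\<^sub>v v"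
    using im by (metis (no_types, lifting) imageE imageI subsetD unit_vec_carrier)
  have "(N\<^sup>T *\<^sub>v y) $ i = (N\<^sup>T *\<^sub>v y) \<bullet> unit_vec t i"
    using N y i by simp
  also have "\<dots> = (M\<^sup>T *\<^sub>v y) \<bullet> v"
    using scalar_prod_mult_transpose[OF N y(1), of "unit_vec t i"]
      scalar_prod_mult_transpose[OF M y(1) v(1)] v(2) by simp
  finally show "(N\<^sup>T *\<^sub>v y) $ i = 0\<^sub>v t $ i"
    using y(2) v(1) i by simp
qed (use N in simp)

text \<open>Passing to \<open>N\<close> with the same column space does not change the kernel of the
  transpose. As \<open>N\<close> has trivial kernel, its transpose is onto, and counting fibres
  finishes. The product form avoids a subtraction of exponents.\<close>

lemma card_kernel_transpose:
  fixes M :: "bit mat"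
  assumes M: "M \<in> carrier_mat r s"
  shows "card {y \<in> carrier_vec r. M\<^sup>T *\<^sub>v y = 0\<^sub>v s} * 2 ^ vec_space.rank r M = 2 ^ r"
proof -
  interpret vec_space "TYPE(bit)" r .
  obtain N where N: "N \<in> carrier_mat r (rank M)"
    and inj: "\<And>v. v \<in> carrier_vec (rank M) \<Longrightarrow> N *\<^sub>v v = 0\<^sub>v r \<Longrightarrow> v = 0\<^sub>v (rank M)"
    and im: "(\<lambda>v. N *\<^sub>v v) ` carrier_vec (rank M) = (\<lambda>v. M *\<^sub>v v) ` carrier_vec s"
    using rank_basis_matrix[OF M] by metis
  have "mat_kernel N = {0\<^sub>v (rank M)}"
    using inj N by (auto simp: mat_kernel_def)
  then have "(\<lambda>y. N\<^sup>T *\<^sub>v y) ` carrier_vec r = carrier_vec (rank M)"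
    using image_transpose_eq_kernel_annihilator[OF N] by auto
  then have card_N: "card {y \<in> carrier_vec r. N\<^sup>T *\<^sub>v y = 0\<^sub>v (rank M)} * 2 ^ rank M = 2 ^ r"
    using card_kernel_times_card_image[of "N\<^sup>T" "rank M" r] N by (simp add: card_bit_vecs)
  have "N\<^sup>T *\<^sub>v y = 0\<^sub>v (rank M) \<longleftrightarrow> M\<^sup>T *\<^sub>v y = 0\<^sub>v s" if "y \<in> carrier_vec r" for y
    using kernel_transpose_cong_image[OF M N equalityD1[OF im] that]
      kernel_transpose_cong_image[OF N M equalityD2[OF im] that] by blast
  then have "{y \<in> carrier_vec r. N\<^sup>T *\<^sub>v y = 0\<^sub>v (rank M)} = {y \<in> carrier_vec r. M\<^sup>T *\<^sub>v y = 0\<^sub>v s}"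
    by (intro Collect_cong conj_cong refl)
  from card_N[unfolded this] show ?thesis .
qed

text \<open>Both sets have 2^(s-r) elements and one contains the other, so no preimage of a kernel
  vector has to be constructed.\<close>

lemma kernel_eq_image_if_full_rank:
  fixes M N :: "bit mat"
  assumes M: "M \<in> carrier_mat r s" and N: "N \<in> carrier_mat s (s - r)"
    and rank: "vec_space.rank r M = r" and le: "r \<le> s"
    and sub: "\<And>v. v \<in> carrier_vec (s - r) \<Longrightarrow> M *\<^sub>v (N *\<^sub>v v) = 0\<^sub>v r"
    and inj: "\<And>v. v \<in> carrier_vec (s - r) \<Longrightarrow> N *\<^sub>v v = 0\<^sub>v s \<Longrightarrow> v = 0\<^sub>v (s - r)"
  shows "mat_kernel M = (\<lambda>v. N *\<^sub>v v) ` carrier_vec (s - r)"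
proof -
  have "card (mat_kernel M) * 2 ^ r = 2 ^ s"
    using card_kernel_times_card_image[OF M] rank M
    by (simp add: card_image_eq_two_power_rank[OF M] mat_kernel[OF M])
  also have "\<dots> = 2 ^ (s - r) * 2 ^ r"
    using le by (simp flip: power_add)
  finally have "card (mat_kernel M) = 2 ^ (s - r)"
    by simp
  also have "\<dots> = card ((\<lambda>v. N *\<^sub>v v) ` carrier_vec (s - r))"
    using card_image[OF inj_on_mult_mat_vec[OF N inj]] by (simp add: card_bit_vecs)
  finally have card: "card ((\<lambda>v. N *\<^sub>v v) ` carrier_vec (s - r)) = card (mat_kernel M)" ..
  have fin: "finite (mat_kernel M)"
    by (rule finite_subset[OF mat_kernel_carrier[OF M] finite_bit_vecs])
  have "(\<lambda>v. N *\<^sub>v v) ` carrier_vec (s - r) \<subseteq> mat_kernel M"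
    using sub N by (auto simp: mat_kernel[OF M])
  from card_subset_eq[OF fin this card] show ?thesis ..
qed

text \<open>Some maximal minor is odd, as 2 does not divide their gcd. Its rows form a square matrix
  that is invertible modulo 2, and these rows alone force \<open>v\<close> to be 0.\<close>

lemma odd_maximal_minor_imp_inj:
  assumes N: "N \<in> carrier_mat s t"
    and gcd: "Gcd (maximal_minors N) = 1"
    and v: "v \<in> carrier_vec t" "mat_mod2 N *\<^sub>v v = 0\<^sub>v s"
  shows "v = 0\<^sub>v t"
proof -
  have "\<not> 2 dvd Gcd (maximal_minors N)"
    using gcd by simp
  then obtain m where "m \<in> maximal_minors N" and odd_m: "odd m"
    using Gcd_greatest[of "maximal_minors N" 2] by blast
  then obtain I where I: "I \<subseteq> {..<s}" "card I = t" and m: "m = det (submatrix N I {..<t})"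
    using N unfolding maximal_minors_def by auto
  let ?S = "submatrix N I {..<t}"
  have cI: "{i. i < s \<and> i \<in> I} = I"
    using I(1) by auto
  have S: "?S \<in> carrier_mat t t"
    using N I by (simp add: submatrix_def cI)
  have pickI: "pick I i < s" if "i < t" for i
    using pick_in_set_le[of i I] that I by auto
  \<comment> \<open>All columns are selected, so picking the \<open>j\<close>-th one returns
    \<open>j\<close>.\<close>
  have pickJ: "pick {..<t} j = j" if "j < t" for j
  proof -
    have "{a \<in> {..<t}. a < j} = {..<j}"
      using that by auto
    then show ?thesis
      using pick_card_in_set[of j "{..<t}"] that by simp
  qed
  have "mat_mod2 ?S *\<^sub>v v = 0\<^sub>v t"
  proof (rule eq_vecI)
    fix i assume "i < dim_vec (0\<^sub>v t :: bit vec)"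
    then have i: "i < t" by simp
    have "row (mat_mod2 ?S) i = row (mat_mod2 N) (pick I i)"
    proof (rule eq_vecI)
      fix j assume "j < dim_vec (row (mat_mod2 N) (pick I i))"
      then have j: "j < t" using N by simp
      have "?S $$ (i, j) = N $$ (pick I i, j)"
        unfolding submatrix_def using N I i j by (simp add: cI pickJ)
      then show "row (mat_mod2 ?S) i $ j = row (mat_mod2 N) (pick I i) $ j"
        using S N i j pickI[OF i] by simp
    qed (use S N in simp)
    moreover have "(mat_mod2 N *\<^sub>v v) $ pick I i = 0"
      using v(2) pickI[OF i] by simp
    ultimately show "(mat_mod2 ?S *\<^sub>v v) $ i = 0\<^sub>v t $ i"
      using pickI[OF i] S N i by simp
  qed (use S in simp)
  moreover have "det (mat_mod2 ?S) \<noteq> 0"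
  proof -
    have "det (mat_mod2 ?S) = of_int m"
      unfolding m by (rule of_int_hom.hom_det)
    also have "\<dots> = 1"
      unfolding of_int_bit using odd_m by (rule if_not_P)
    finally show ?thesis
      by (rule ssubst) (rule one_neq_zero)
  qed
  moreover have "mat_mod2 ?S \<in> carrier_mat t t"
    using S by simp
  ultimately show ?thesis
    using det_0_iff_vec_prod_zero_field[of "mat_mod2 ?S" t] v(1) by metis
qed

section \<open>Counting and signs\<close>

lemma num_elems_bij_betw:
  assumes "bij_betw f S T"
  shows "num_elems S = num_elems T"
  using bij_betw_finite[OF assms] bij_betw_same_card[OF assms] by (simp add: num_elems_def)

lemma num_elems_Un_disjoint:
  assumes "S \<inter> T = {}"
  shows "num_elems (S \<union> T) = num_elems S + num_elems T"
  using assms by (auto simp: num_elems_def card_Un_disjoint)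

lemma num_elems_UN_disjoint:
  assumes "finite I" and "\<And>i j. i \<in> I \<Longrightarrow> j \<in> I \<Longrightarrow> i \<noteq> j \<Longrightarrow> U i \<inter> U j = {}"
  shows "num_elems (\<Union>i\<in>I. U i) = (\<Sum>i\<in>I. num_elems (U i))"
  using assms
proof (induction I rule: finite_induct)
  case empty
  show ?case by (simp add: num_elems_def)
next
  case (insert i I)
  have "U i \<inter> (\<Union>j\<in>I. U j) = {}"
    using insert.prems insert.hyps(2) by fastforce
  then show ?case
    using insert by (simp add: num_elems_Un_disjoint)
qed

text \<open>The group isomorphism from F_2 onto {1, -1}: through it a product of signs with integer
  exponents becomes a dot product modulo 2.\<close>

definition sign_of_bit :: "bit \<Rightarrow> real" where
  "sign_of_bit b = (if b = 0 then 1 else -1)"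

lemma sign_of_bit_nonzero [simp]: "sign_of_bit b \<noteq> 0"
  and abs_sign_of_bit [simp]: "\<bar>sign_of_bit b\<bar> = 1"
  and sign_of_bit_0 [simp]: "sign_of_bit 0 = 1"
  by (simp_all add: sign_of_bit_def)

lemma sign_of_bit_add: "sign_of_bit (b + c) = sign_of_bit b * sign_of_bit c"
  by (cases b; cases c) (simp_all add: sign_of_bit_def)

lemma sign_of_bit_sum: "sign_of_bit (sum f I) = (\<Prod>i\<in>I. sign_of_bit (f i))"
proof (induction I rule: infinite_finite_induct)
  case (insert i I)
  then show ?case by (simp only: sum.insert prod.insert sign_of_bit_add not_False_eq_True)
qed simp_all

lemma power_int_sign_of_bit: "sign_of_bit b powi m = sign_of_bit (b * of_int m)"
  by (cases b) (auto simp: sign_of_bit_def of_int_bit power_int_minus_left)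

lemma power_int_minus_one_eq_sign_of_bit: "(-1) powi m = sign_of_bit (of_int m)"
  using power_int_sign_of_bit[of 1 m] by (simp add: sign_of_bit_def)

lemma sign_exp_decomposition:
  assumes "z \<noteq> 0"
  obtains b where "z = sign_of_bit b * exp (ln \<bar>z\<bar>)"
proof (cases "z > 0")
  case True
  then show thesis using that[of 0] by simp
next
  case False
  then show thesis using that[of 1] assms by (simp add: sign_of_bit_def)
qed

lemma sign_exp_eq_iff:
  "sign_of_bit b * exp x = sign_of_bit c * exp y \<longleftrightarrow> b = c \<and> x = y"
proof
  assume eq: "sign_of_bit b * exp x = sign_of_bit c * exp y"
  then have "\<bar>sign_of_bit b * exp x\<bar> = \<bar>sign_of_bit c * exp y\<bar>"
    by simp
  then have "x = y" by (simp add: abs_mult)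
  with eq show "b = c \<and> x = y"
    by (cases b; cases c) (auto simp: sign_of_bit_def)
qed simp

text \<open>Inverse of the map sending a vector without zero entries to its signs and the logarithms
  of its absolute values.\<close>

definition signed_exp :: "bit vec \<Rightarrow> real vec \<Rightarrow> real vec" where
  "signed_exp w l = vec (dim_vec w) (\<lambda>j. sign_of_bit (w $ j) * exp (l $ j))"

lemma carrier_vec_Suc: "(carrier_vec (Suc m) :: 'a vec set) = (\<Union>c. vCons c ` carrier_vec m)"
proof (intro equalityI subsetI)
  fix v :: "'a vec"
  assume "v \<in> carrier_vec (Suc m)"
  then show "v \<in> (\<Union>c. vCons c ` carrier_vec m)"
    by (cases v) auto
qed auto

lemma orthogonal_to_columns:
  fixes N :: "'a :: comm_ring_1 mat"
  assumes N: "N \<in> carrier_mat s t" and w: "w \<in> carrier_vec s"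
    and cols: "\<And>j. j < t \<Longrightarrow> w \<bullet> col N j = 0" and y: "y \<in> carrier_vec t"
  shows "w \<bullet> (N *\<^sub>v y) = 0"
proof -
  have "N\<^sup>T *\<^sub>v w = 0\<^sub>v t"
    using N w cols by (intro eq_vecI) (auto simp: comm_scalar_prod[of _ s])
  then show ?thesis
    using scalar_prod_mult_transpose[OF N w y] y by simp
qed

section \<open>The polynomial system and its Gale dual\<close>

locale gale_pair =
  fixes d n k :: nat
    and a :: "nat \<Rightarrow> int vec"
    and A B :: "int mat"
    and C D :: "real mat"
  assumes n_ge: "n \<ge> d + 2"
    and k_eq: "k = n - d - 1"
    and points: "\<forall>j<n. a j \<in> carrier_vec d"
    and A_eq: "A = point_matrix d n a"
    and rank_A: "vec_space.rank (d + 1) (real_mat A) = d + 1"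
    and C_carrier: "C \<in> carrier_mat d n"
    and B_carrier: "B \<in> carrier_mat n k"
    and gale_B: "int_gale_dual A B"
    and D_carrier: "D \<in> carrier_mat n (k + 1)"
    and gale_D: "gale_dual C D"
begin

lemma A_carrier: "A \<in> carrier_mat (d + 1) n"
  using mat_of_cols_carrier(1)[of "d + 1" "map (\<lambda>j. vCons 1 (a j)) [0..<n]"]
  by (simp add: A_eq point_matrix_def)

lemma col_A: "j < n \<Longrightarrow> col A j = vCons 1 (a j)"
  using points by (simp add: A_eq point_matrix_def)

lemma real_A_carrier: "real_mat A \<in> carrier_mat (d + 1) n"
  and mod2_A_carrier: "mat_mod2 A \<in> carrier_mat (d + 1) n"
  and real_B_carrier: "real_mat B \<in> carrier_mat n k"
  and mod2_B_carrier: "mat_mod2 B \<in> carrier_mat n k"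
  using A_carrier B_carrier by simp_all

lemma n_minus: "n - (d + 1) = k" "n - d = k + 1"
  using n_ge k_eq by simp_all

lemma kernel_real_A: "mat_kernel (real_mat A) = (\<lambda>y. real_mat B *\<^sub>v y) ` carrier_vec k"
  using gale_dual_kernel(2)[of "real_mat A" "real_mat B" "d + 1" n] gale_B real_A_carrier n_minus
  by (simp add: int_gale_dual_def)

lemma kernel_C: "mat_kernel C = (\<lambda>y. D *\<^sub>v y) ` carrier_vec (k + 1)"
  using gale_dual_kernel(2)[OF gale_D C_carrier] n_minus by simp

lemma D_inj: "inj_on (\<lambda>y. D *\<^sub>v y) (carrier_vec (k + 1))"
  using inj_on_mult_mat_vec[OF D_carrier] gale_dual_kernel(3)[OF gale_D C_carrier] n_minus by simp

text \<open>Gale duality is given over the reals; reduction modulo 2 requires the identity between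
  integers.\<close>

lemma A_mult_B: "A * B = 0\<^sub>m (d + 1) k"
proof (rule eq_matI)
  fix i j assume "i < dim_row (0\<^sub>m (d + 1) k :: int mat)" "j < dim_col (0\<^sub>m (d + 1) k :: int mat)"
  then have i: "i < d + 1" and j: "j < k" by simp_all
  have unit: "real_mat B *\<^sub>v unit_vec k j = col (real_mat B) j"
    using j B_carrier by (intro eq_vecI) auto
  have "real_mat B *\<^sub>v unit_vec k j \<in> mat_kernel (real_mat A)"
    using kernel_real_A by simp
  then have "real_mat A *\<^sub>v col (real_mat B) j = 0\<^sub>v (d + 1)"
    using mat_kernelD(2)[OF real_A_carrier] unit by simp
  then have "(real_mat A *\<^sub>v col (real_mat B) j) $ i = 0"
    using i by simp
  then have "real_of_int ((A * B) $$ (i, j)) = 0"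
    using i j A_carrier B_carrier by (simp add: scalar_prod_def)
  then show "(A * B) $$ (i, j) = 0\<^sub>m (d + 1) k $$ (i, j)"
    using i j by simp
qed (use A_carrier B_carrier in auto)

lemma mod2_A_mult_B: "mat_mod2 A * mat_mod2 B = 0\<^sub>m (d + 1) k"
proof -
  have "mat_mod2 A * mat_mod2 B = mat_mod2 (A * B)"
    by (rule of_int_hom.mat_hom_mult[OF A_carrier B_carrier, symmetric])
  then show ?thesis
    unfolding A_mult_B by (auto intro: eq_matI)
qed

section \<open>Affine forms and sign patterns on the points\<close>

definition lin_forms :: "real vec \<Rightarrow> real vec" where
  "lin_forms v = (real_mat A)\<^sup>T *\<^sub>v v"

definition sign_patterns :: "bit vec \<Rightarrow> bit vec" where
  "sign_patterns t = (mat_mod2 A)\<^sup>T *\<^sub>v t"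

lemma lin_forms_carrier: "lin_forms v \<in> carrier_vec n"
  and sign_patterns_carrier: "sign_patterns t \<in> carrier_vec n"
  using A_carrier by (auto simp: lin_forms_def sign_patterns_def intro!: carrier_vecI)

lemma row_transpose_map_A:
  "j < n \<Longrightarrow> row (map_mat f A)\<^sup>T j = vCons (f 1) (map_vec f (a j))"
proof -
  assume j: "j < n"
  have "map_vec f (vCons 1 (a j)) = vCons (f 1) (map_vec f (a j))"
    by (rule eq_vecI) (auto simp: less_Suc_eq_0_disj)
  then show ?thesis
    using j A_carrier by (simp add: col_A)
qed

lemma lin_forms_vCons:
  assumes "j < n" "u \<in> carrier_vec d"
  shows "lin_forms (vCons c u) $ j = c + (\<Sum>l<d. real_of_int (a j $ l) * u $ l)"
proof -
  have "lin_forms (vCons c u) $ j = row (real_mat A)\<^sup>T j \<bullet> vCons c u"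
    using assms A_carrier by (simp add: lin_forms_def)
  also have "\<dots> = c + map_vec real_of_int (a j) \<bullet> u"
    using assms by (simp add: row_transpose_map_A del: row_transpose)
  finally show ?thesis
    using assms points by (auto simp: scalar_prod_def lessThan_atLeast0 intro!: sum.cong)
qed

lemma sign_patterns_vCons:
  assumes "j < n" "s \<in> carrier_vec d"
  shows "sign_patterns (vCons c s) $ j = c + (\<Sum>l<d. s $ l * of_int (a j $ l))"
proof -
  have "sign_patterns (vCons c s) $ j = row (mat_mod2 A)\<^sup>T j \<bullet> vCons c s"
    using assms A_carrier by (simp add: sign_patterns_def)
  also have "\<dots> = c + vec_mod2 (a j) \<bullet> s"
    using assms by (simp add: row_transpose_map_A del: row_transpose)
  also have "vec_mod2 (a j) \<bullet> s = (\<Sum>l<d. s $ l * of_int (a j $ l))"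
    unfolding scalar_prod_def carrier_vecD[OF assms(2)] lessThan_atLeast0
    by (rule sum.cong[OF refl], subst mult.commute) (use assms points in auto)
  finally show ?thesis .
qed

text \<open>An affine form is determined by its values on the points, since A has full row rank.
  This makes both the scale of \<open>y\<close> and the vector \<open>u\<close> unique.\<close>

lemma lin_forms_inj: "inj_on lin_forms (carrier_vec (d + 1))"
  unfolding lin_forms_def
  by (rule inj_on_mult_mat_vec[of _ n])
    (use real_A_carrier full_row_rank_transpose_inj[OF real_A_carrier rank_A] in auto)

text \<open>The leading 0 fixes the constant term of the affine form. For (S) it reflects that
  monomials carry no constant factor, for (G) it selects one point on each ray.\<close>

definition reduced_solutions :: "bit vec \<Rightarrow> real vec set" where
  "reduced_solutions w =
     {u \<in> carrier_vec d. C *\<^sub>v signed_exp w (lin_forms (vCons 0 u)) = 0\<^sub>v d}"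

section \<open>The polynomial system, orthant by orthant\<close>

definition torus_point :: "bit vec \<Rightarrow> real vec \<Rightarrow> real vec" where
  "torus_point s u = vec d (\<lambda>l. sign_of_bit (s $ l) * exp (u $ l))"

lemma monomial_torus_point:
  assumes s: "s \<in> carrier_vec d" and u: "u \<in> carrier_vec d" and j: "j < n"
  shows "monomial d (torus_point s u) (a j) =
    signed_exp (sign_patterns (vCons 0 s)) (lin_forms (vCons 0 u)) $ j"
proof -
  have "monomial d (torus_point s u) (a j) =
      (\<Prod>l<d. sign_of_bit (s $ l * of_int (a j $ l)) * exp (real_of_int (a j $ l) * u $ l))"
    unfolding monomial_def torus_point_def
    by (rule prod.cong) (simp_all add: power_int_mult_distrib power_int_sign_of_bit exp_power_int)
  also have "\<dots> = sign_of_bit (sign_patterns (vCons 0 s) $ j) * exp (lin_forms (vCons 0 u) $ j)"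
    unfolding lin_forms_vCons[OF j u] sign_patterns_vCons[OF j s] add_0
      sign_of_bit_sum exp_sum[OF finite_lessThan] prod.distrib ..
  finally show ?thesis
    using j carrier_vecD[OF sign_patterns_carrier] by (simp add: signed_exp_def)
qed

lemma torus_point_solution_iff:
  assumes "s \<in> carrier_vec d" and "u \<in> carrier_vec d"
  shows "torus_point s u \<in> torus_solutions d n a C \<longleftrightarrow>
    u \<in> reduced_solutions (sign_patterns (vCons 0 s))"
proof -
  let ?z = "signed_exp (sign_patterns (vCons 0 s)) (lin_forms (vCons 0 u))"
  have dim: "dim_vec ?z = n"
    using carrier_vecD[OF sign_patterns_carrier] by (simp add: signed_exp_def)
  have "(C *\<^sub>v ?z) $ i = (\<Sum>j<n. C $$ (i, j) * monomial d (torus_point s u) (a j))" if "i < d" for i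
    using that C_carrier dim assms
    by (simp add: scalar_prod_def monomial_torus_point lessThan_atLeast0)
  then have "C *\<^sub>v ?z = 0\<^sub>v d \<longleftrightarrow>
      (\<forall>i<d. (\<Sum>j<n. C $$ (i, j) * monomial d (torus_point s u) (a j)) = 0)"
    using C_carrier by (auto simp: vec_eq_iff)
  then show ?thesis
    using assms by (simp add: torus_solutions_def reduced_solutions_def torus_point_def)
qed

lemma torus_point_eq_iff:
  assumes "s \<in> carrier_vec d" "s' \<in> carrier_vec d" "u \<in> carrier_vec d" "u' \<in> carrier_vec d"
  shows "torus_point s u = torus_point s' u' \<longleftrightarrow> s = s' \<and> u = u'"
  using assms by (auto simp: torus_point_def vec_eq_iff sign_exp_eq_iff)

lemma torus_point_surj:
  assumes x: "x \<in> carrier_vec d" and nz: "\<And>l. l < d \<Longrightarrow> x $ l \<noteq> 0"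
  obtains s u where "s \<in> carrier_vec d" "u \<in> carrier_vec d" "x = torus_point s u"
proof -
  have "\<exists>b. x $ l = sign_of_bit b * exp (ln \<bar>x $ l\<bar>)" if "l < d" for l
    using sign_exp_decomposition[OF nz[OF that]] by metis
  then obtain b where b: "\<And>l. l < d \<Longrightarrow> x $ l = sign_of_bit (b l) * exp (ln \<bar>x $ l\<bar>)"
    by metis
  have "x = torus_point (vec d b) (vec d (\<lambda>l. ln \<bar>x $ l\<bar>))"
  proof (rule eq_vecI)
    fix l
    assume "l < dim_vec (torus_point (vec d b) (vec d (\<lambda>l. ln \<bar>x $ l\<bar>)))"
    then have "l < d" by (simp add: torus_point_def)
    then show "x $ l = torus_point (vec d b) (vec d (\<lambda>l. ln \<bar>x $ l\<bar>)) $ l"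
      using b[of l] by (simp add: torus_point_def)
  qed (use x in \<open>simp add: torus_point_def\<close>)
  then show thesis
    using that[of "vec d b" "vec d (\<lambda>l. ln \<bar>x $ l\<bar>)"] by simp
qed

lemma torus_solutions_eq_UN:
  "torus_solutions d n a C =
    (\<Union>s\<in>carrier_vec d. torus_point s ` reduced_solutions (sign_patterns (vCons 0 s)))"
proof (intro equalityI subsetI)
  fix x assume x: "x \<in> torus_solutions d n a C"
  then obtain s u where su: "s \<in> carrier_vec d" "u \<in> carrier_vec d" "x = torus_point s u"
    using torus_point_surj[of x] by (auto simp: torus_solutions_def)
  then show "x \<in> (\<Union>s\<in>carrier_vec d. torus_point s ` reduced_solutions (sign_patterns (vCons 0 s)))"
    using x torus_point_solution_iff[of s u] by blast
next
  fix x assume "x \<in> (\<Union>s\<in>carrier_vec d. torus_point s ` reduced_solutions (sign_patterns (vCons 0 s)))"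
  then obtain s u where su: "s \<in> carrier_vec d" "u \<in> reduced_solutions (sign_patterns (vCons 0 s))"
      "x = torus_point s u"
    by blast
  moreover have "u \<in> carrier_vec d"
    using su(2) by (simp add: reduced_solutions_def)
  ultimately show "x \<in> torus_solutions d n a C"
    using torus_point_solution_iff[of s u] by blast
qed

lemma reduced_solutions_subset: "reduced_solutions w \<subseteq> carrier_vec d"
  by (auto simp: reduced_solutions_def)

text \<open>One term for each of the 2^d open orthants, which are disjoint;
  \<open>torus_point s\<close> parametrises the orthant with signs \<open>s\<close>
  bijectively.\<close>

lemma num_torus_solutions:
  "num_elems (torus_solutions d n a C) =
    (\<Sum>s\<in>carrier_vec d. num_elems (reduced_solutions (sign_patterns (vCons 0 s))))"
proof -
  have "num_elems (torus_solutions d n a C) = (\<Sum>s\<in>carrier_vec d.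
      num_elems (torus_point s ` reduced_solutions (sign_patterns (vCons 0 s))))"
    unfolding torus_solutions_eq_UN
  proof (rule num_elems_UN_disjoint[OF finite_bit_vecs])
    fix s s' :: "bit vec"
    assume s: "s \<in> carrier_vec d" "s' \<in> carrier_vec d" "s \<noteq> s'"
    show "torus_point s ` reduced_solutions (sign_patterns (vCons 0 s)) \<inter>
        torus_point s' ` reduced_solutions (sign_patterns (vCons 0 s')) = {}"
      using torus_point_eq_iff[OF s(1,2)] s(3) reduced_solutions_subset by blast
  qed
  also have "\<dots> = (\<Sum>s\<in>carrier_vec d. num_elems (reduced_solutions (sign_patterns (vCons 0 s))))"
  proof (rule sum.cong[OF refl])
    fix s :: "bit vec"
    assume s: "s \<in> carrier_vec d"
    have "inj_on (torus_point s) (reduced_solutions (sign_patterns (vCons 0 s)))"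
      using torus_point_eq_iff[OF s s] reduced_solutions_subset by (meson inj_onI subsetD)
    then show "num_elems (torus_point s ` reduced_solutions (sign_patterns (vCons 0 s))) =
        num_elems (reduced_solutions (sign_patterns (vCons 0 s)))"
      by (rule num_elems_bij_betw[OF inj_on_imp_bij_betw, symmetric])
  qed
  finally show ?thesis .
qed

section \<open>Opposite sign patterns\<close>

lemma signed_exp_sign_patterns_one:
  assumes "s \<in> carrier_vec d"
  shows "signed_exp (sign_patterns (vCons 1 s)) l = - signed_exp (sign_patterns (vCons 0 s)) l"
  using assms carrier_vecD[OF sign_patterns_carrier]
  by (intro eq_vecI)
    (simp_all add: signed_exp_def sign_patterns_vCons sign_of_bit_add, simp add: sign_of_bit_def)

lemma reduced_solutions_vCons_one:
  assumes s: "s \<in> carrier_vec d"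
  shows "reduced_solutions (sign_patterns (vCons 1 s)) = reduced_solutions (sign_patterns (vCons 0 s))"
proof -
  have "C *\<^sub>v (- z) = 0\<^sub>v d \<longleftrightarrow> C *\<^sub>v z = 0\<^sub>v d" if "z \<in> carrier_vec n" for z
  proof -
    have "C *\<^sub>v (- z) = - (C *\<^sub>v z)"
      using C_carrier that by (intro eq_vecI) auto
    then show ?thesis
      using C_carrier by (auto simp: vec_eq_iff)
  qed
  moreover have "signed_exp (sign_patterns (vCons 0 s)) l \<in> carrier_vec n" for l
    using carrier_vecD[OF sign_patterns_carrier] by (intro carrier_vecI) (simp add: signed_exp_def)
  ultimately show ?thesis
    unfolding reduced_solutions_def by (simp add: signed_exp_sign_patterns_one[OF s])
qed

text \<open>Doubling lets the sum run over the whole domain F_2^(d+1) of the linear map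
  \<open>sign_patterns\<close>, to which the fibre count applies.\<close>

lemma two_times_num_torus_solutions:
  "2 * num_elems (torus_solutions d n a C) =
    (\<Sum>t\<in>carrier_vec (d + 1). num_elems (reduced_solutions (sign_patterns t)))"
proof -
  let ?g = "\<lambda>t. num_elems (reduced_solutions (sign_patterns t))"
  have split: "carrier_vec (d + 1) = vCons (0 :: bit) ` carrier_vec d \<union> vCons 1 ` carrier_vec d"
    by (simp add: carrier_vec_Suc UNIV_bit)
  have inj: "inj_on (vCons c) X" for c :: bit and X
    by (rule inj_onI) simp
  have "(\<Sum>t\<in>carrier_vec (d + 1). ?g t) =
      (\<Sum>t\<in>vCons 0 ` carrier_vec d. ?g t) + (\<Sum>t\<in>vCons 1 ` carrier_vec d. ?g t)"
    unfolding split by (rule sum.union_disjoint) (auto simp: finite_bit_vecs)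
  also have "\<dots> = (\<Sum>s\<in>carrier_vec d. ?g (vCons 0 s)) + (\<Sum>s\<in>carrier_vec d. ?g (vCons 1 s))"
    by (simp add: sum.reindex[OF inj])
  also have "\<dots> = 2 * num_elems (torus_solutions d n a C)"
    by (simp add: num_torus_solutions reduced_solutions_vCons_one mult_2)
  finally show ?thesis ..
qed

section \<open>Feasible sign vectors\<close>

lemma sign_patterns_image:
  "sign_patterns ` carrier_vec (d + 1) =
    {w \<in> carrier_vec n. \<forall>\<beta>\<in>mat_kernel (mat_mod2 A). w \<bullet> \<beta> = 0}"
  unfolding sign_patterns_def by (rule image_transpose_eq_kernel_annihilator[OF mod2_A_carrier])

lemma feasible_iff:
  "\<epsilon> \<in> feasible A \<longleftrightarrow> \<epsilon> \<in> carrier_vec n \<and> vec_mod2 \<epsilon> \<in> sign_patterns ` carrier_vec (d + 1)"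
  unfolding sign_patterns_image feasible_def using A_carrier by auto

text \<open>The inverse lifts every bit to the integer 0 or 1. Sums over representatives thereby
  become sums over the image of \<open>sign_patterns\<close>.\<close>

lemma bij_betw_feasible_mod2:
  "bij_betw vec_mod2 (feasible_mod2 A) (sign_patterns ` carrier_vec (d + 1))"
proof (rule bij_betwI)
  let ?g = "map_vec (\<lambda>b :: bit. if b = 0 then 0 else 1 :: int)"
  show "vec_mod2 \<in> feasible_mod2 A \<rightarrow> sign_patterns ` carrier_vec (d + 1)"
    by (auto simp: feasible_mod2_def feasible_iff)
  have vg: "vec_mod2 (?g w) = w" for w
    by (rule eq_vecI) auto
  show "?g \<in> sign_patterns ` carrier_vec (d + 1) \<rightarrow> feasible_mod2 A"
  proof (rule Pi_I)
    fix w assume w: "w \<in> sign_patterns ` carrier_vec (d + 1)"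
    then have "w \<in> carrier_vec n"
      using sign_patterns_carrier by blast
    then show "?g w \<in> feasible_mod2 A"
      using w vg[of w] A_carrier by (simp add: feasible_mod2_def feasible_iff)
  qed
  show "vec_mod2 (?g w) = w" for w
    by (rule vg)
  show "?g (vec_mod2 \<epsilon>) = \<epsilon>" if "\<epsilon> \<in> feasible_mod2 A" for \<epsilon>
  proof (rule eq_vecI)
    fix i assume "i < dim_vec \<epsilon>"
    moreover have "\<epsilon> \<in> carrier_vec n" and "\<forall>i<n. \<epsilon> $ i \<in> {0, 1}"
      using that A_carrier by (auto simp: feasible_mod2_def feasible_iff)
    ultimately show "?g (vec_mod2 \<epsilon>) $ i = \<epsilon> $ i"
      by auto
  qed simp
qed

section \<open>The Gale system in signs and logarithms\<close>

lemma lin_forms_orthogonal_B: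
  assumes v: "v \<in> carrier_vec (d + 1)" and j: "j < k"
  shows "(\<Sum>i<n. of_int (B $$ (i, j)) * lin_forms v $ i) = 0"
proof -
  have "real_mat B *\<^sub>v unit_vec k j \<in> mat_kernel (real_mat A)"
    using kernel_real_A by simp
  then have "lin_forms v \<bullet> (real_mat B *\<^sub>v unit_vec k j) = 0"
    using scalar_prod_mult_transpose[OF real_A_carrier v] v mat_kernelD[OF real_A_carrier]
    by (simp add: lin_forms_def)
  moreover have "real_mat B *\<^sub>v unit_vec k j = col (real_mat B) j"
    using j B_carrier by (intro eq_vecI) auto
  ultimately show ?thesis
    using j B_carrier by (simp add: scalar_prod_def lessThan_atLeast0 mult.commute)
qed

text \<open>The columns of [B]_2 lie in ker [A]_2 whatever the rank of [A]_2, and patterns in the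
  image are orthogonal to that kernel.\<close>

lemma sign_patterns_orthogonal_B:
  assumes w: "w \<in> sign_patterns ` carrier_vec (d + 1)" and j: "j < k"
  shows "(\<Sum>i<n. w $ i * of_int (B $$ (i, j))) = 0"
proof -
  have "mat_mod2 A *\<^sub>v col (mat_mod2 B) j = col (mat_mod2 A * mat_mod2 B) j"
    using col_mult2[OF mod2_A_carrier mod2_B_carrier j] by simp
  then have "col (mat_mod2 B) j \<in> mat_kernel (mat_mod2 A)"
    using j mod2_A_carrier mod2_B_carrier
    by (intro mat_kernelI[OF mod2_A_carrier]) (simp_all add: mod2_A_mult_B)
  then have "w \<bullet> col (mat_mod2 B) j = 0"
    using w unfolding sign_patterns_image by blast
  moreover have "w \<bullet> col (mat_mod2 B) j = (\<Sum>i<n. w $ i * of_int (B $$ (i, j)))"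
    unfolding scalar_prod_def lessThan_atLeast0 using j B_carrier by (intro sum.cong) auto
  ultimately show ?thesis by simp
qed

text \<open>The system splits into a parity condition on the signs and a linear condition on the
  logarithms.\<close>

lemma gale_system_signed_exp_iff:
  assumes y: "D *\<^sub>v y = signed_exp w l" and w: "w \<in> carrier_vec n"
  shows "gale_system B D y \<longleftrightarrow> (\<forall>j<k.
    sign_of_bit (\<Sum>i<n. w $ i * of_int (B $$ (i, j))) * exp (\<Sum>i<n. of_int (B $$ (i, j)) * l $ i) = 1)"
proof -
  have row: "row D i \<bullet> y = sign_of_bit (w $ i) * exp (l $ i)" if "i < n" for i
    using arg_cong[OF y, of "\<lambda>z. z $ i"] that D_carrier w by (simp add: signed_exp_def)
  have "(\<Prod>i<n. (row D i \<bullet> y) powi (B $$ (i, j))) =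
      (\<Prod>i<n. sign_of_bit (w $ i * of_int (B $$ (i, j))) * exp (of_int (B $$ (i, j)) * l $ i))" for j
    by (rule prod.cong) (simp_all add: row power_int_mult_distrib power_int_sign_of_bit exp_power_int)
  then have "(\<Prod>i<n. (row D i \<bullet> y) powi (B $$ (i, j))) =
      sign_of_bit (\<Sum>i<n. w $ i * of_int (B $$ (i, j))) * exp (\<Sum>i<n. of_int (B $$ (i, j)) * l $ i)" for j
    unfolding prod.distrib sign_of_bit_sum exp_sum[OF finite_lessThan] .
  then show ?thesis
    using B_carrier by (simp add: gale_system_def)
qed

lemma sign_cone_signed_exp_iff:
  assumes y: "y \<in> carrier_vec (k + 1)" "D *\<^sub>v y = signed_exp w l"
    and w: "w \<in> carrier_vec n" and \<epsilon>: "\<epsilon> \<in> carrier_vec n"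
  shows "y \<in> sign_cone D \<epsilon> \<longleftrightarrow> w = vec_mod2 \<epsilon>"
proof -
  have row: "row D i \<bullet> y = sign_of_bit (w $ i) * exp (l $ i)" if "i < n" for i
    using arg_cong[OF y(2), of "\<lambda>z. z $ i"] that D_carrier w by (simp add: signed_exp_def)
  have "0 < (-1) powi (\<epsilon> $ i) * (row D i \<bullet> y) \<longleftrightarrow> w $ i = vec_mod2 \<epsilon> $ i" if "i < n" for i
    unfolding row[OF that] power_int_minus_one_eq_sign_of_bit
    using that \<epsilon> by (cases "w $ i"; cases "of_int (\<epsilon> $ i) :: bit") (simp_all add: sign_of_bit_def)
  then show ?thesis
    using y(1) w \<epsilon> D_carrier by (auto simp: sign_cone_def vec_eq_iff)
qed

lemma form_complement_signed_exp:
  assumes y: "y \<in> form_complement D"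
  obtains w l where "w \<in> carrier_vec n" "l \<in> carrier_vec n" "D *\<^sub>v y = signed_exp w l"
proof -
  have "\<exists>b. row D i \<bullet> y = sign_of_bit b * exp (ln \<bar>row D i \<bullet> y\<bar>)" if "i < n" for i
  proof -
    have "row D i \<bullet> y \<noteq> 0"
      using that y D_carrier by (auto simp: form_complement_def)
    then show ?thesis
      using sign_exp_decomposition by metis
  qed
  then obtain b where b: "\<And>i. i < n \<Longrightarrow> row D i \<bullet> y = sign_of_bit (b i) * exp (ln \<bar>row D i \<bullet> y\<bar>)"
    by metis
  have "D *\<^sub>v y = signed_exp (vec n b) (vec n (\<lambda>i. ln \<bar>row D i \<bullet> y\<bar>))"
  proof (rule eq_vecI)
    fix i assume "i < dim_vec (signed_exp (vec n b) (vec n (\<lambda>i. ln \<bar>row D i \<bullet> y\<bar>)))"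
    then have "i < n" by (simp add: signed_exp_def)
    then show "(D *\<^sub>v y) $ i = signed_exp (vec n b) (vec n (\<lambda>i. ln \<bar>row D i \<bullet> y\<bar>)) $ i"
      using b[of i] D_carrier by (simp add: signed_exp_def)
  qed (use D_carrier in \<open>simp add: signed_exp_def\<close>)
  then show thesis
    using that[of "vec n b" "vec n (\<lambda>i. ln \<bar>row D i \<bullet> y\<bar>)"] by simp
qed

lemma sign_cone_subset_form_complement: "sign_cone D \<epsilon> \<subseteq> form_complement D"
  by (auto simp: sign_cone_def form_complement_def)

text \<open>Real Gale duality: the logarithms of the absolute values of the forms are orthogonal to the
  columns of \<open>B\<close>, hence are values of an affine form on the points.\<close>

lemma gale_system_imp_lin_forms:
  assumes y: "D *\<^sub>v y = signed_exp w l" and w: "w \<in> carrier_vec n" and l: "l \<in> carrier_vec n"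
    and sys: "gale_system B D y"
  obtains v where "v \<in> carrier_vec (d + 1)" "l = lin_forms v"
    and "\<And>j. j < k \<Longrightarrow> (\<Sum>i<n. w $ i * of_int (B $$ (i, j))) = 0"
proof -
  let ?b = "\<lambda>j. \<Sum>i<n. w $ i * of_int (B $$ (i, j))"
  let ?x = "\<lambda>j. \<Sum>i<n. real_of_int (B $$ (i, j)) * l $ i"
  \<comment> \<open>Writing 1 as \<open>sign_of_bit 0 * exp 0\<close> lets uniqueness of sign and
    logarithm give both conditions at once.\<close>
  have "sign_of_bit (?b j) * exp (?x j) = sign_of_bit 0 * exp 0" if "j < k" for j
    using sys that unfolding gale_system_signed_exp_iff[OF y w] by simp
  then have b: "?b j = 0" and x: "?x j = 0" if "j < k" for j
    using that unfolding sign_exp_eq_iff by blast+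
  have "l \<bullet> col (real_mat B) j = ?x j" if "j < k" for j
    using that B_carrier by (simp add: scalar_prod_def lessThan_atLeast0 mult.commute)
  then have "l \<bullet> (real_mat B *\<^sub>v c) = 0" if "c \<in> carrier_vec k" for c
    using orthogonal_to_columns[OF real_B_carrier l _ that] x by simp
  then have "\<forall>v\<in>mat_kernel (real_mat A). l \<bullet> v = 0"
    unfolding kernel_real_A by blast
  then have "l \<in> lin_forms ` carrier_vec (d + 1)"
    unfolding lin_forms_def image_transpose_eq_kernel_annihilator[OF real_A_carrier] using l by blast
  then show thesis
    using that b by blast
qed

text \<open>The row of ones in A makes the constant term act as a positive scaling, which is why
  rays are the right objects on the Gale side.\<close>

lemma signed_exp_lin_forms_vCons:
  assumes "w \<in> carrier_vec n" "u \<in> carrier_vec d"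
  shows "signed_exp w (lin_forms (vCons c u)) = exp c \<cdot>\<^sub>v signed_exp w (lin_forms (vCons 0 u))"
  using assms by (intro eq_vecI) (simp_all add: signed_exp_def lin_forms_vCons exp_add)

lemma signed_exp_carrier: "w \<in> carrier_vec m \<Longrightarrow> signed_exp w l \<in> carrier_vec m"
  by (simp add: signed_exp_def)

lemma reduced_solutions_iff:
  assumes "w \<in> carrier_vec n" "u \<in> carrier_vec d"
  shows "u \<in> reduced_solutions w \<longleftrightarrow>
    (\<exists>y\<in>carrier_vec (k + 1). D *\<^sub>v y = signed_exp w (lin_forms (vCons 0 u)))"
proof -
  have "u \<in> reduced_solutions w \<longleftrightarrow> signed_exp w (lin_forms (vCons 0 u)) \<in> mat_kernel C"
    using assms signed_exp_carrier[OF assms(1)] C_carrier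
    by (simp add: reduced_solutions_def mat_kernel[OF C_carrier])
  then show ?thesis
    unfolding kernel_C image_iff by metis
qed

section \<open>Passage between Gale solutions and reduced solutions\<close>

lemma gale_solution_imp_reduced_solution:
  assumes y: "y \<in> sign_cone D \<epsilon>" and \<epsilon>: "\<epsilon> \<in> carrier_vec n" and sys: "gale_system B D y"
  obtains c u where "u \<in> reduced_solutions (vec_mod2 \<epsilon>)"
    and "D *\<^sub>v y = exp c \<cdot>\<^sub>v signed_exp (vec_mod2 \<epsilon>) (lin_forms (vCons 0 u))"
proof -
  have yc: "y \<in> carrier_vec (k + 1)"
    using y D_carrier by (simp add: sign_cone_def)
  obtain w l where w: "w \<in> carrier_vec n" and l: "l \<in> carrier_vec n" and Dy: "D *\<^sub>v y = signed_exp w l"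
    using form_complement_signed_exp sign_cone_subset_form_complement y by blast
  have w_eq: "w = vec_mod2 \<epsilon>"
    using sign_cone_signed_exp_iff[OF yc Dy w \<epsilon>] y by simp
  obtain v where v: "v \<in> carrier_vec (d + 1)" "l = lin_forms v"
    using gale_system_imp_lin_forms[OF Dy w l sys] by blast
  obtain c u where v_eq: "v = vCons c u" and u: "u \<in> carrier_vec d"
    using v(1) by (auto simp: carrier_vec_Suc)
  have Dy': "D *\<^sub>v y = exp c \<cdot>\<^sub>v signed_exp w (lin_forms (vCons 0 u))"
    using Dy signed_exp_lin_forms_vCons[OF w u, of c] by (simp add: v(2) v_eq)
  have "D *\<^sub>v (exp (- c) \<cdot>\<^sub>v y) = signed_exp w (lin_forms (vCons 0 u))"
    using mult_mat_vec[OF D_carrier yc] Dy' by (simp add: smult_smult_assoc flip: exp_add)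
  moreover have "exp (- c) \<cdot>\<^sub>v y \<in> carrier_vec (k + 1)"
    using yc by simp
  ultimately have "u \<in> reduced_solutions w"
    using reduced_solutions_iff[OF w u] by blast
  then show thesis
    using that Dy' w_eq by blast
qed

text \<open>For a reduced solution such a vector exists because ker C is the image of
  \<open>D\<close>, and it is unique because \<open>D\<close> is injective.\<close>

definition gale_point :: "bit vec \<Rightarrow> real vec \<Rightarrow> real vec" where
  "gale_point w u = (SOME y. y \<in> carrier_vec (k + 1) \<and> D *\<^sub>v y = signed_exp w (lin_forms (vCons 0 u)))"

lemma gale_point:
  assumes "w \<in> carrier_vec n" "u \<in> reduced_solutions w"
  shows "gale_point w u \<in> carrier_vec (k + 1)"
    and "D *\<^sub>v gale_point w u = signed_exp w (lin_forms (vCons 0 u))"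
proof -
  have "\<exists>y. y \<in> carrier_vec (k + 1) \<and> D *\<^sub>v y = signed_exp w (lin_forms (vCons 0 u))"
    using reduced_solutions_iff[OF assms(1)] assms(2) reduced_solutions_subset by blast
  from someI_ex[OF this] show "gale_point w u \<in> carrier_vec (k + 1)"
    "D *\<^sub>v gale_point w u = signed_exp w (lin_forms (vCons 0 u))"
    unfolding gale_point_def by blast+
qed

text \<open>The parity half of (G) is feasibility tested on the columns of \<open>B\<close>; the
  logarithmic half holds for the values of every affine form.\<close>

lemma gale_point_solution:
  assumes \<epsilon>: "\<epsilon> \<in> feasible A" and u: "u \<in> reduced_solutions (vec_mod2 \<epsilon>)"
  shows "gale_point (vec_mod2 \<epsilon>) u \<in> sign_cone D \<epsilon>"
    and "gale_system B D (gale_point (vec_mod2 \<epsilon>) u)"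
proof -
  have \<epsilon>c: "\<epsilon> \<in> carrier_vec n" and w: "vec_mod2 \<epsilon> \<in> carrier_vec n"
    and im: "vec_mod2 \<epsilon> \<in> sign_patterns ` carrier_vec (d + 1)"
    using \<epsilon> by (simp_all add: feasible_iff)
  note p = gale_point[OF w u]
  show "gale_point (vec_mod2 \<epsilon>) u \<in> sign_cone D \<epsilon>"
    using sign_cone_signed_exp_iff[OF p w \<epsilon>c] by simp
  have "vCons 0 u \<in> carrier_vec (d + 1)"
    using u reduced_solutions_subset by fastforce
  then show "gale_system B D (gale_point (vec_mod2 \<epsilon>) u)"
    unfolding gale_system_signed_exp_iff[OF p(2) w]
    using sign_patterns_orthogonal_B[OF im] lin_forms_orthogonal_B by simp
qed

section \<open>Rays of a cone and their count\<close>

lemma ray_rel_Image_smult: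
  assumes "c > 0" "y \<in> carrier_vec m"
  shows "ray_rel m `` {c \<cdot>\<^sub>v y} = ray_rel m `` {y}"
proof -
  have "(\<exists>\<alpha>>0. c \<cdot>\<^sub>v y = \<alpha> \<cdot>\<^sub>v y') \<longleftrightarrow> (\<exists>\<alpha>>0. y = \<alpha> \<cdot>\<^sub>v y')" if "y' \<in> carrier_vec m" for y'
  proof
    assume "\<exists>\<alpha>>0. c \<cdot>\<^sub>v y = \<alpha> \<cdot>\<^sub>v y'"
    then obtain \<alpha> where \<alpha>: "\<alpha> > 0" "c \<cdot>\<^sub>v y = \<alpha> \<cdot>\<^sub>v y'" by blast
    have "y = (1 / c) \<cdot>\<^sub>v (c \<cdot>\<^sub>v y)"
      using assms(1) by (simp add: smult_smult_assoc)
    also have "\<dots> = (\<alpha> / c) \<cdot>\<^sub>v y'"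
      by (simp add: \<alpha>(2) smult_smult_assoc)
    finally show "\<exists>\<alpha>>0. y = \<alpha> \<cdot>\<^sub>v y'"
      using \<alpha>(1) assms(1) by (metis divide_pos_pos)
  next
    assume "\<exists>\<alpha>>0. y = \<alpha> \<cdot>\<^sub>v y'"
    then obtain \<alpha> where "\<alpha> > 0" "y = \<alpha> \<cdot>\<^sub>v y'" by blast
    then show "\<exists>\<alpha>>0. c \<cdot>\<^sub>v y = \<alpha> \<cdot>\<^sub>v y'"
      using assms(1) by (intro exI[of _ "c * \<alpha>"]) (simp add: smult_smult_assoc)
  qed
  then show ?thesis
    using assms by (auto simp: ray_rel_def)
qed

lemma mem_own_ray: "y \<in> carrier_vec m \<Longrightarrow> y \<in> ray_rel m `` {y}"
  by (auto simp: ray_rel_def intro!: exI[of _ 1])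

lemma ray_subset_sign_cone:
  assumes y: "y \<in> sign_cone D \<epsilon>" and y': "y' \<in> ray_rel (k + 1) `` {y}"
  shows "y' \<in> sign_cone D \<epsilon>"
proof -
  obtain \<alpha> where \<alpha>: "\<alpha> > 0" "y = \<alpha> \<cdot>\<^sub>v y'" and c: "y' \<in> carrier_vec (k + 1)"
    using y' by (auto simp: ray_rel_def)
  have "0 < (-1) powi (\<epsilon> $ i) * (row D i \<bullet> y')" if "i < n" for i
  proof -
    have "0 < \<alpha> * ((-1) powi (\<epsilon> $ i) * (row D i \<bullet> y'))"
      using y that D_carrier c unfolding \<alpha>(2) by (simp add: sign_cone_def mult.left_commute)
    then show ?thesis
      using \<alpha>(1) by (simp add: zero_less_mult_iff)
  qed
  then show ?thesis
    using c D_carrier by (simp add: sign_cone_def)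
qed

text \<open>The map sending \<open>u\<close> to the ray through
  \<open>gale_point (vec_mod2 \<epsilon>) u\<close> is a bijection. It hits every solution ray
  because a solution is such a point up to the positive factor \<open>exp c\<close>.\<close>

lemma num_quotient_cone_solutions:
  assumes \<epsilon>: "\<epsilon> \<in> feasible A"
  shows "num_elems (quotient_cone_solutions B D \<epsilon>) = num_elems (reduced_solutions (vec_mod2 \<epsilon>))"
proof -
  let ?w = "vec_mod2 \<epsilon>"
  let ?ray = "\<lambda>u. ray_rel (k + 1) `` {gale_point ?w u}"
  have \<epsilon>c: "\<epsilon> \<in> carrier_vec n" and w: "?w \<in> carrier_vec n"
    using \<epsilon> by (simp_all add: feasible_iff)
  have inj: "inj_on ?ray (reduced_solutions ?w)"
  proof (rule inj_onI)
    fix u u' assume u: "u \<in> reduced_solutions ?w" "u' \<in> reduced_solutions ?w" and eq: "?ray u = ?ray u'"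
    note p = gale_point[OF w u(1)] and p' = gale_point[OF w u(2)]
    have uc: "u \<in> carrier_vec d" "u' \<in> carrier_vec d"
      using u reduced_solutions_subset by blast+
    have "gale_point ?w u' \<in> ?ray u"
      using mem_own_ray[OF p'(1)] eq by simp
    then obtain \<alpha> where \<alpha>: "\<alpha> > 0" "gale_point ?w u = \<alpha> \<cdot>\<^sub>v gale_point ?w u'"
      by (auto simp: ray_rel_def)
    have "signed_exp ?w (lin_forms (vCons 0 u)) = \<alpha> \<cdot>\<^sub>v signed_exp ?w (lin_forms (vCons 0 u'))"
      using p(2) p'(2) \<alpha>(2) mult_mat_vec[OF D_carrier p'(1)] by simp
    \<comment> \<open>A positive ratio of two points on one ray becomes a shift of the constant term
      by its logarithm; injectivity of \<open>lin_forms\<close> then forces the shift to be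
      0.\<close>
    also have "\<dots> = signed_exp ?w (lin_forms (vCons (ln \<alpha>) u'))"
      using signed_exp_lin_forms_vCons[OF w uc(2), of "ln \<alpha>"] \<alpha>(1) by simp
    finally have eq: "signed_exp ?w (lin_forms (vCons 0 u)) = signed_exp ?w (lin_forms (vCons (ln \<alpha>) u'))" .
    have "lin_forms (vCons 0 u) = lin_forms (vCons (ln \<alpha>) u')"
    proof (rule eq_vecI)
      fix i assume "i < dim_vec (lin_forms (vCons (ln \<alpha>) u'))"
      then have "i < n" using carrier_vecD[OF lin_forms_carrier] by simp
      then show "lin_forms (vCons 0 u) $ i = lin_forms (vCons (ln \<alpha>) u') $ i"
        using arg_cong[OF eq, of "\<lambda>z. z $ i"] w by (simp add: signed_exp_def sign_exp_eq_iff)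
    qed (simp add: carrier_vecD[OF lin_forms_carrier])
    then have "vCons 0 u = vCons (ln \<alpha>) u'"
      by (rule inj_onD[OF lin_forms_inj]) (use uc in simp_all)
    then show "u = u'" by simp
  qed
  have "?ray ` reduced_solutions ?w = quotient_cone_solutions B D \<epsilon>"
  proof (intro equalityI subsetI)
    fix Y assume "Y \<in> ?ray ` reduced_solutions ?w"
    then obtain u where u: "u \<in> reduced_solutions ?w" and Y: "Y = ?ray u" by blast
    then show "Y \<in> quotient_cone_solutions B D \<epsilon>"
      using gale_point_solution[OF \<epsilon> u] mem_own_ray[OF gale_point(1)[OF w u]] D_carrier
      by (auto simp: quotient_cone_solutions_def quotient_cone_def quotient_def)
  next
    fix Y assume "Y \<in> quotient_cone_solutions B D \<epsilon>"
    \<comment> \<open>\<open>y0\<close> generates the class, whereas the system is known at some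
      member \<open>y\<close>. Both are positive multiples of each other, so \<open>y\<close> lies
      in the same cone and generates the same class.\<close>
    then obtain y0 y where y0: "y0 \<in> sign_cone D \<epsilon>" and Y: "Y = ray_rel (k + 1) `` {y0}"
      and y: "y \<in> Y" and sys: "gale_system B D y"
      using D_carrier by (auto simp: quotient_cone_solutions_def quotient_cone_def quotient_def)
    have ycone: "y \<in> sign_cone D \<epsilon>"
      using ray_subset_sign_cone[OF y0] y Y by simp
    then have yc: "y \<in> carrier_vec (k + 1)"
      using D_carrier by (simp add: sign_cone_def)
    obtain \<alpha> where \<alpha>: "\<alpha> > 0" "y0 = \<alpha> \<cdot>\<^sub>v y"
      using y Y by (auto simp: ray_rel_def)
    obtain c u where u: "u \<in> reduced_solutions ?w"
      and Dy: "D *\<^sub>v y = exp c \<cdot>\<^sub>v signed_exp ?w (lin_forms (vCons 0 u))"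
      using gale_solution_imp_reduced_solution[OF ycone \<epsilon>c sys] by blast
    note p = gale_point[OF w u]
    have "D *\<^sub>v y = D *\<^sub>v (exp c \<cdot>\<^sub>v gale_point ?w u)"
      using Dy p(2) mult_mat_vec[OF D_carrier p(1)] by simp
    then have "y = exp c \<cdot>\<^sub>v gale_point ?w u"
      by (rule inj_onD[OF D_inj]) (use yc p(1) in simp_all)
    then have "Y = ?ray u"
      using Y \<alpha> yc p(1) by (simp add: ray_rel_Image_smult)
    then show "Y \<in> ?ray ` reduced_solutions ?w"
      using u by blast
  qed
  then show ?thesis
    using num_elems_bij_betw[OF inj_on_imp_bij_betw[OF inj]] by simp
qed

section \<open>The number of solutions\<close>

lemma sum_num_quotient_cone_solutions:
  "(\<Sum>\<epsilon>\<in>feasible_mod2 A. num_elems (quotient_cone_solutions B D \<epsilon>)) =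
    (\<Sum>w\<in>sign_patterns ` carrier_vec (d + 1). num_elems (reduced_solutions w))"
proof -
  have "(\<Sum>\<epsilon>\<in>feasible_mod2 A. num_elems (quotient_cone_solutions B D \<epsilon>)) =
      (\<Sum>\<epsilon>\<in>feasible_mod2 A. num_elems (reduced_solutions (vec_mod2 \<epsilon>)))"
    by (rule sum.cong) (auto simp: feasible_mod2_def num_quotient_cone_solutions)
  then show ?thesis
    using sum.reindex_bij_betw[OF bij_betw_feasible_mod2, of "\<lambda>w. num_elems (reduced_solutions w)"]
    by simp
qed

text \<open>Regrouping twice the number of solutions by the fibres of \<open>sign_patterns\<close>
  gives the factor 2^(d+1-r). Exponents are integer differences: at \<open>r = d + 1\<close> a
  truncated \<open>d - r\<close> would give 1 in place of 1/2.\<close>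

lemma num_torus_solutions_eq:
  defines "r \<equiv> vec_space.rank (d + 1) (mat_mod2 A)"
  shows "num_elems (torus_solutions d n a C) = ennreal (2 powi (int d - int r)) *
    (\<Sum>\<epsilon>\<in>feasible_mod2 A. num_elems (quotient_cone_solutions B D \<epsilon>))"
proof -
  let ?N = "num_elems (torus_solutions d n a C)"
  let ?S = "\<Sum>\<epsilon>\<in>feasible_mod2 A. num_elems (quotient_cone_solutions B D \<epsilon>)"
  let ?q = "card {t \<in> carrier_vec (d + 1). (mat_mod2 A)\<^sup>T *\<^sub>v t = 0\<^sub>v n}"
  have "2 * ?N = of_nat ?q * ?S"
    using sum_over_image_mult_mat_vec[of "(mat_mod2 A)\<^sup>T" n "d + 1" "\<lambda>w. num_elems (reduced_solutions w)"]
      mod2_A_carrier two_times_num_torus_solutions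
    by (simp add: sum_num_quotient_cone_solutions sign_patterns_def)
  also have "(of_nat ?q :: ennreal) = ennreal (2 powi (int (d + 1) - int r))"
  proof -
    have "real (?q * 2 ^ r) = real (2 ^ (d + 1))"
      unfolding r_def by (rule arg_cong[OF card_kernel_transpose[OF mod2_A_carrier]])
    then have "real ?q * 2 ^ r = 2 ^ (d + 1)"
      by (simp only: of_nat_mult of_nat_power of_nat_numeral)
    then have "real ?q = 2 ^ (d + 1) / 2 ^ r"
      by (simp only: nonzero_eq_divide_eq[OF power_not_zero[OF zero_neq_numeral[symmetric]]])
    also have "\<dots> = 2 powi (int (d + 1) - int r)"
      using power_int_diff[of "2 :: real" "int (d + 1)" "int r"] unfolding power_int_of_nat by simp
    finally have "real ?q = 2 powi (int (d + 1) - int r)" .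
    then show ?thesis
      unfolding ennreal_of_nat_eq_real_of_nat by (rule arg_cong)
  qed
  also have "ennreal (2 powi (int (d + 1) - int r)) = 2 * ennreal (2 powi (int d - int r))"
  proof -
    have "int (d + 1) - int r = 1 + (int d - int r)"
      by simp
    then have "(2 :: real) powi (int (d + 1) - int r) = 2 powi (1 + (int d - int r))"
      by (rule arg_cong)
    also have "\<dots> = 2 powi 1 * 2 powi (int d - int r)"
      by (rule power_int_add) simp
    finally have "(2 :: real) powi (int (d + 1) - int r) = 2 * 2 powi (int d - int r)"
      unfolding power_int_1_right .
    then show ?thesis
      by (simp only: ennreal_mult' ennreal_numeral zero_le_numeral)
  qed
  finally have "2 * ?N = 2 * (ennreal (2 powi (int d - int r)) * ?S)"
    by (simp add: mult.assoc)
  \<comment> \<open>In \<open>ennreal\<close> the number 2 is neither 0 nor infinite, so it cancels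
    even when \<open>?N\<close> is infinite.\<close>
  then show ?thesis
    by (simp add: ennreal_mult_cancel_left)
qed

section \<open>Existence of solutions\<close>

lemma ex_lift_mod2:
  assumes "w \<in> sign_patterns ` carrier_vec (d + 1)"
  obtains \<epsilon> where "\<epsilon> \<in> feasible A" "vec_mod2 \<epsilon> = w"
proof -
  have "w \<in> vec_mod2 ` feasible_mod2 A"
    using assms unfolding bij_betw_imp_surj_on[OF bij_betw_feasible_mod2] .
  then show thesis
    using that by (auto simp: feasible_mod2_def)
qed

lemma torus_solutions_nonempty_iff:
  "torus_solutions d n a C \<noteq> {} \<longleftrightarrow>
    (\<exists>\<epsilon>\<in>feasible A. \<exists>y\<in>sign_cone D \<epsilon>. gale_system B D y)"
proof
  assume "torus_solutions d n a C \<noteq> {}"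
  then obtain s u where s: "s \<in> carrier_vec d" and u: "u \<in> reduced_solutions (sign_patterns (vCons 0 s))"
    unfolding torus_solutions_eq_UN by blast
  have "sign_patterns (vCons 0 s) \<in> sign_patterns ` carrier_vec (d + 1)"
    using s by (intro imageI) simp
  then obtain \<epsilon> where "\<epsilon> \<in> feasible A" "vec_mod2 \<epsilon> = sign_patterns (vCons 0 s)"
    by (rule ex_lift_mod2)
  then show "\<exists>\<epsilon>\<in>feasible A. \<exists>y\<in>sign_cone D \<epsilon>. gale_system B D y"
    using gale_point_solution u by metis
next
  assume "\<exists>\<epsilon>\<in>feasible A. \<exists>y\<in>sign_cone D \<epsilon>. gale_system B D y"
  then obtain \<epsilon> y where \<epsilon>: "\<epsilon> \<in> feasible A" and y: "y \<in> sign_cone D \<epsilon>" "gale_system B D y"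
    by blast
  then obtain u where u: "u \<in> reduced_solutions (vec_mod2 \<epsilon>)"
    using gale_solution_imp_reduced_solution by (metis feasible_iff)
  obtain t where t: "t \<in> carrier_vec (d + 1)" "vec_mod2 \<epsilon> = sign_patterns t"
    using \<epsilon> by (auto simp: feasible_iff)
  then obtain c s where t_eq: "t = vCons c s" and s: "s \<in> carrier_vec d"
    by (auto simp: carrier_vec_Suc)
  \<comment> \<open>A leading bit \<open>c = 1\<close> only reverses all signs, so \<open>s\<close>
    alone already gives an orthant containing a solution.\<close>
  have "u \<in> reduced_solutions (sign_patterns (vCons 0 s))"
    using u t(2) reduced_solutions_vCons_one[OF s] by (cases c) (auto simp: t_eq)
  then show "torus_solutions d n a C \<noteq> {}"
    unfolding torus_solutions_eq_UN using s by blast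
qed

text \<open>The parity half of (G) makes the signs of \<open>y\<close> orthogonal to the columns of
  [B]_2. At full rank modulo 2 these columns span ker [A]_2, and orthogonality to that kernel is
  feasibility.\<close>

lemma form_complement_solution_imp_feasible:
  assumes rank: "vec_space.rank (d + 1) (mat_mod2 A) = d + 1"
    and y: "y \<in> form_complement D" and sys: "gale_system B D y"
  obtains \<epsilon> where "\<epsilon> \<in> feasible A" "y \<in> sign_cone D \<epsilon>"
proof -
  obtain w l where w: "w \<in> carrier_vec n" and l: "l \<in> carrier_vec n" and Dy: "D *\<^sub>v y = signed_exp w l"
    using form_complement_signed_exp[OF y] .
  have orth: "(\<Sum>i<n. w $ i * of_int (B $$ (i, j))) = 0" if "j < k" for j
    using gale_system_imp_lin_forms[OF Dy w l sys] that by blast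
  have "w \<bullet> col (mat_mod2 B) j = 0" if "j < k" for j
  proof -
    have "w \<bullet> col (mat_mod2 B) j = (\<Sum>i<n. w $ i * of_int (B $$ (i, j)))"
      unfolding scalar_prod_def lessThan_atLeast0 using that B_carrier by (intro sum.cong) auto
    then show ?thesis using orth[OF that] by simp
  qed
  then have orth_B: "w \<bullet> (mat_mod2 B *\<^sub>v c) = 0" if "c \<in> carrier_vec k" for c
    by (rule orthogonal_to_columns[OF mod2_B_carrier w _ that])
  have "mat_kernel (mat_mod2 A) = (\<lambda>c. mat_mod2 B *\<^sub>v c) ` carrier_vec (n - (d + 1))"
  proof (rule kernel_eq_image_if_full_rank[OF mod2_A_carrier _ rank])
    show "mat_mod2 B \<in> carrier_mat n (n - (d + 1))"
      using B_carrier n_minus by simp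
    show "d + 1 \<le> n"
      using n_ge by simp
    show "mat_mod2 A *\<^sub>v (mat_mod2 B *\<^sub>v v) = 0\<^sub>v (d + 1)" if "v \<in> carrier_vec (n - (d + 1))" for v
    proof -
      have v: "v \<in> carrier_vec k"
        using that n_minus by simp
      have "0\<^sub>m (d + 1) k *\<^sub>v v = 0\<^sub>v (d + 1)"
        using v by (intro eq_vecI) auto
      then show ?thesis
        using assoc_mult_mat_vec[OF mod2_A_carrier mod2_B_carrier v] by (simp add: mod2_A_mult_B)
    qed
    show "v = 0\<^sub>v (n - (d + 1))"
      if "v \<in> carrier_vec (n - (d + 1))" "mat_mod2 B *\<^sub>v v = 0\<^sub>v n" for v
      using odd_maximal_minor_imp_inj[OF B_carrier] gale_B that n_minus by (simp add: int_gale_dual_def)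
  qed
  then have ker: "mat_kernel (mat_mod2 A) = (\<lambda>c. mat_mod2 B *\<^sub>v c) ` carrier_vec k"
    unfolding n_minus .
  have "w \<bullet> \<beta> = 0" if "\<beta> \<in> mat_kernel (mat_mod2 A)" for \<beta>
    using that orth_B unfolding ker by (elim imageE) simp
  then have "w \<in> sign_patterns ` carrier_vec (d + 1)"
    unfolding sign_patterns_image using w by simp
  then obtain \<epsilon> where \<epsilon>: "\<epsilon> \<in> feasible A" "vec_mod2 \<epsilon> = w"
    by (rule ex_lift_mod2)
  have yc: "y \<in> carrier_vec (k + 1)"
    using y D_carrier by (simp add: form_complement_def)
  have "\<epsilon> \<in> carrier_vec n"
    using \<epsilon>(1) by (simp add: feasible_iff)
  then have "y \<in> sign_cone D \<epsilon>"
    using sign_cone_signed_exp_iff[OF yc Dy w] \<epsilon>(2) by simp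
  with \<epsilon>(1) show thesis by (rule that)
qed

lemma torus_solutions_nonempty_iff_full_rank:
  assumes "vec_space.rank (d + 1) (mat_mod2 A) = d + 1"
  shows "torus_solutions d n a C \<noteq> {} \<longleftrightarrow> (\<exists>y\<in>form_complement D. gale_system B D y)"
  unfolding torus_solutions_nonempty_iff
proof
  assume "\<exists>\<epsilon>\<in>feasible A. \<exists>y\<in>sign_cone D \<epsilon>. gale_system B D y"
  then obtain \<epsilon> y where "y \<in> sign_cone D \<epsilon>" "gale_system B D y"
    by (elim bexE)
  then show "\<exists>y\<in>form_complement D. gale_system B D y"
    by (intro bexI[of _ y] subsetD[OF sign_cone_subset_form_complement])
next
  assume "\<exists>y\<in>form_complement D. gale_system B D y"
  then obtain y where y: "y \<in> form_complement D" "gale_system B D y"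
    by (elim bexE)
  obtain \<epsilon> where \<epsilon>: "\<epsilon> \<in> feasible A" "y \<in> sign_cone D \<epsilon>"
    by (rule form_complement_solution_imp_feasible[OF assms y])
  show "\<exists>\<epsilon>\<in>feasible A. \<exists>y\<in>sign_cone D \<epsilon>. gale_system B D y"
    by (intro bexI[OF _ \<epsilon>(1)] bexI[OF _ \<epsilon>(2)] y(2))
qed

end

theorem theorem6p10:
  fixes d n k :: nat
    and a :: "nat \<Rightarrow> int vec"
    and A B :: "int mat"
    and C D :: "real mat"
  assumes "d \<ge> 1"
    and "n \<ge> d + 2"
    and "k = n - d - 1"
    and "\<forall>j<n. a j \<in> carrier_vec d"
    and "inj_on a {..<n}"
    and "A = point_matrix d n a"
    and "vec_space.rank (d + 1) (real_mat A) = d + 1"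
    and "C \<in> carrier_mat d n"
    and "vec_space.rank d C = d"
    and "B \<in> carrier_mat n k"
    and "int_gale_dual A B"
    and "D \<in> carrier_mat n (k + 1)"
    and "gale_dual C D"
  shows "(vec_space.rank (d + 1) (mat_mod2 A) = d + 1 \<longrightarrow>
            (torus_solutions d n a C \<noteq> {} \<longleftrightarrow>
             (\<exists>y \<in> form_complement D. gale_system B D y)))
       \<and> (torus_solutions d n a C \<noteq> {} \<longleftrightarrow>
             (\<exists>\<epsilon> \<in> feasible A. \<exists>y \<in> sign_cone D \<epsilon>. gale_system B D y))
       \<and> num_elems (torus_solutions d n a C) =
           ennreal (2 powi (int d - int (vec_space.rank (d + 1) (mat_mod2 A)))) *
           (\<Sum>\<epsilon> \<in> feasible_mod2 A. num_elems (quotient_cone_solutions B D \<epsilon>))"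
proof -
  interpret gale_pair d n k a A B C D
    by unfold_locales (rule assms)+
  show ?thesis
    by (intro conjI impI torus_solutions_nonempty_iff_full_rank torus_solutions_nonempty_iff
        num_torus_solutions_eq)
qed

end
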